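(* For a measure algebra $(\mathfrak A,\overline\mu)$, the following are equivalent: (1) $(\mathfrak A,\overline\mu)$ is localizable; (2) $(\mathfrak A,\overline\mu)$ is isomorphic to the measure algebra of a localizable measure space; (3) $(\mathfrak A,\overline\mu)$ is isomorphic to the measure algebra of a decomposable measure space; (4) $(\mathfrak A,\overline\mu)$ is isomorphic to the measure algebra of a Radon measure space $(X,\mathfrak T,\mathscr B,\mu)$.
   Context: A measure algebra is a Dedekind $\sigma$-complete Boolean algebra $\mathfrak A$ (countable subsets have suprema) with a function $\overline\mu:\mathfrak A\to[0,\infty]$ such that $\overline\mu(p)=0$ iff $p=0$, and $\overline\mu(\sup_n p_n)=\sum_n\overline\mu(p_n)$ for every countable set $\{p_n\}$ of mutually disjoint elements. It is semifinite if for every nonzero $p$ there is a nonzero $q\le p$ with $\overline\mu(q)<\infty$, and localizable if it is semifinite and $\mathfrak A$ is Dedekind complete (every increasing net, equivalently every subset, has a least upper bound). Two measure algebras are isomorphic if there is a Boolean isomorphism $\pi$ between them with $\overline\mu_1\circ\pi=\overline\mu_0$. The measure algebra of a measure space $(X,\Sigma,\mu)$ is the quotient Boolean algebra $\Sigma/\mathcal Z(\Sigma)$, where $\mathcal Z(\Sigma)$ is the ideal of sets of measure $0$, with $\overline\mu([E])=\mu(E)$. A measure space $(X,\Sigma,\mu)$ is localizable if $\mu$ is semifinite (every set of infinite measure contains a measurable subset of strictly positive finite measure) and every increasing net of projections of $L^\infty(X,\Sigma,\mu)$ has a supremum in the lattice of projections. It is decomposable if $X$ can be partitioned into measurable sets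 $X_t$ of finite measure such that $\Sigma=\{E\subset X: E\cap X_t\in\Sigma\text{ for all }t\}$ and $\mu(E)=\sum_t\mu(E\cap X_t)$ for all $E\in\Sigma$. A Radon measure space is a quadruple $(X,\mathfrak T,\mathscr B,\mu)$ such that: (i) $(X,\mathscr B,\mu)$ is a complete measure space; (ii) if $E\subseteq X$ and $E\cap F\in\mathscr B$ for all $F\in\mathscr B$ with $\mu(F)<\infty$, then $E\in\mathscr B$; (iii) $\mathfrak T$ is a Hausdorff topology on $X$; (iv) $\mathfrak T\subset\mathscr B$; (v) for every $E\in\mathscr B$, $\mu(E)=\sup\{\mu(C): C\subseteq E,\ C\text{ compact}\}$; (vi) every $x\in X$ has an open neighborhood $U$ with $\mu(U)<\infty$. *)

theory Defs
  imports "HOL-Algebra.Lattice" "HOL-Analysis.Analysis"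
begin

section \<open>Measure algebras\<close>

text \<open>
  Boolean algebras are treated as complemented distributive lattices, with explicit carriers
  (the quotient of a \<open>\<sigma>\<close>-algebra by its null ideal is not a type).
\<close>

locale boolean_lattice = bounded_lattice L for L (structure) +
  assumes meet_join_distrib:
    "\<lbrakk>x \<in> carrier L; y \<in> carrier L; z \<in> carrier L\<rbrakk> \<Longrightarrow> x \<sqinter> (y \<squnion> z) = (x \<sqinter> y) \<squnion> (x \<sqinter> z)"
  and complement_exists:
    "x \<in> carrier L \<Longrightarrow> \<exists>y\<in>carrier L. x \<squnion> y = \<top> \<and> x \<sqinter> y = \<bottom>"

locale measure_algebra = boolean_lattice L for L (structure) +
  fixes \<mu> :: "'a \<Rightarrow> ennreal"
  assumes countable_sup_exists:
    "\<lbrakk>C \<subseteq> carrier L; countable C\<rbrakk> \<Longrightarrow> \<exists>s. least L s (Upper L C)"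
  and measure_zero_iff:
    "p \<in> carrier L \<Longrightarrow> \<mu> p = 0 \<longleftrightarrow> p = \<bottom>"
  and countably_additive:
    "\<lbrakk>C \<subseteq> carrier L; countable C; \<And>p q. \<lbrakk>p \<in> C; q \<in> C; p \<noteq> q\<rbrakk> \<Longrightarrow> p \<sqinter> q = \<bottom>\<rbrakk>
      \<Longrightarrow> \<mu> (\<Squnion>C) = (\<Sum>\<^sub>\<infinity>p\<in>C. \<mu> p)"

definition malg_semifinite :: "'a gorder \<Rightarrow> ('a \<Rightarrow> ennreal) \<Rightarrow> bool" where
  "malg_semifinite L \<mu> \<longleftrightarrow>
    (\<forall>p\<in>carrier L. p \<noteq> \<bottom>\<^bsub>L\<^esub> \<longrightarrow>
      (\<exists>q\<in>carrier L. q \<noteq> \<bottom>\<^bsub>L\<^esub> \<and> q \<sqsubseteq>\<^bsub>L\<^esub> p \<and> \<mu> q < \<infinity>))"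

definition dedekind_complete :: "'a gorder \<Rightarrow> bool" where
  "dedekind_complete L \<longleftrightarrow> (\<forall>D\<subseteq>carrier L. \<exists>s. least L s (Upper L D))"

definition malg_localizable :: "'a gorder \<Rightarrow> ('a \<Rightarrow> ennreal) \<Rightarrow> bool" where
  "malg_localizable L \<mu> \<longleftrightarrow> malg_semifinite L \<mu> \<and> dedekind_complete L"

text \<open>Complements are unique, so they are preserved by the maps below as well.\<close>

definition boolean_iso :: "'a gorder \<Rightarrow> 'b gorder \<Rightarrow> ('a \<Rightarrow> 'b) \<Rightarrow> bool" where
  "boolean_iso L L' \<pi> \<longleftrightarrow>
    bij_betw \<pi> (carrier L) (carrier L') \<and>
    (\<forall>p\<in>carrier L. \<forall>q\<in>carrier L. \<pi> (p \<squnion>\<^bsub>L\<^esub> q) = \<pi> p \<squnion>\<^bsub>L'\<^esub> \<pi> q) \<and>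
    (\<forall>p\<in>carrier L. \<forall>q\<in>carrier L. \<pi> (p \<sqinter>\<^bsub>L\<^esub> q) = \<pi> p \<sqinter>\<^bsub>L'\<^esub> \<pi> q) \<and>
    \<pi> \<bottom>\<^bsub>L\<^esub> = \<bottom>\<^bsub>L'\<^esub> \<and> \<pi> \<top>\<^bsub>L\<^esub> = \<top>\<^bsub>L'\<^esub>"

definition malg_isomorphic ::
    "'a gorder \<Rightarrow> ('a \<Rightarrow> ennreal) \<Rightarrow> 'b gorder \<Rightarrow> ('b \<Rightarrow> ennreal) \<Rightarrow> bool" where
  "malg_isomorphic L \<mu> L' \<nu> \<longleftrightarrow>
    (\<exists>\<pi>. boolean_iso L L' \<pi> \<and> (\<forall>p\<in>carrier L. \<nu> (\<pi> p) = \<mu> p))"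


section \<open>The measure algebra of a measure space\<close>

definition null_rel :: "'b measure \<Rightarrow> ('b set \<times> 'b set) set" where
  "null_rel M = {(E, F). E \<in> sets M \<and> F \<in> sets M \<and> (E - F) \<union> (F - E) \<in> null_sets M}"

definition malg :: "'b measure \<Rightarrow> 'b set set gorder" where
  "malg M =
    \<lparr>carrier = sets M // null_rel M,
     eq = (=),
     le = (\<lambda>P Q. \<exists>E\<in>P. \<exists>F\<in>Q. E - F \<in> null_sets M)\<rparr>"

text \<open>The measure is constant on each class, so its image is a singleton.\<close>

definition malg_measure :: "'b measure \<Rightarrow> 'b set set \<Rightarrow> ennreal" where
  "malg_measure M P = the_elem (emeasure M ` P)"


section \<open>The projections of \<open>L\<^sup>\<infinity>\<close>\<close>

definition ess_bounded_fun :: "'b measure \<Rightarrow> ('b \<Rightarrow> complex) set" where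
  "ess_bounded_fun M = {f \<in> borel_measurable M. \<exists>c::real. AE x in M. cmod (f x) \<le> c}"

definition ae_rel :: "'b measure \<Rightarrow> (('b \<Rightarrow> complex) \<times> ('b \<Rightarrow> complex)) set" where
  "ae_rel M = {(f, g). f \<in> ess_bounded_fun M \<and> g \<in> ess_bounded_fun M \<and> (AE x in M. f x = g x)}"

definition Linf :: "'b measure \<Rightarrow> ('b \<Rightarrow> complex) set set" where
  "Linf M = ess_bounded_fun M // ae_rel M"

definition Linf_mult ::
    "'b measure \<Rightarrow> ('b \<Rightarrow> complex) set \<Rightarrow> ('b \<Rightarrow> complex) set \<Rightarrow> ('b \<Rightarrow> complex) set" where
  "Linf_mult M p q = (\<Union>f\<in>p. \<Union>g\<in>q. ae_rel M `` {\<lambda>x. f x * g x})"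

definition Linf_star :: "'b measure \<Rightarrow> ('b \<Rightarrow> complex) set \<Rightarrow> ('b \<Rightarrow> complex) set" where
  "Linf_star M p = (\<Union>f\<in>p. ae_rel M `` {\<lambda>x. cnj (f x)})"

text \<open>Self-adjoint idempotents, with the usual order of projections: \<open>p \<le> q\<close> iff \<open>p q = p\<close>.\<close>

definition Linf_projections :: "'b measure \<Rightarrow> ('b \<Rightarrow> complex) set gorder" where
  "Linf_projections M =
    \<lparr>carrier = {p \<in> Linf M. Linf_star M p = p \<and> Linf_mult M p p = p},
     eq = (=),
     le = (\<lambda>p q. Linf_mult M p q = p)\<rparr>"


section \<open>Classes of measure spaces\<close>

text \<open>
  The library's locale \<open>semifinite_measure\<close> does not demand that the subset have nonzero
  measure, so it holds for every measure (take the empty set) and cannot be used here.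
\<close>

definition semifinite_space :: "'b measure \<Rightarrow> bool" where
  "semifinite_space M \<longleftrightarrow>
    (\<forall>E\<in>sets M. emeasure M E = \<infinity> \<longrightarrow>
      (\<exists>F\<in>sets M. F \<subseteq> E \<and> 0 < emeasure M F \<and> emeasure M F < \<infinity>))"

text \<open>
  An increasing net and its range, an upward directed set, have the same upper bounds; conversely
  a directed set is an increasing net indexed by itself.
\<close>

definition directed_subset :: "'a gorder \<Rightarrow> 'a set \<Rightarrow> bool" where
  "directed_subset L D \<longleftrightarrow>
    D \<noteq> {} \<and> D \<subseteq> carrier L \<and>
    (\<forall>p\<in>D. \<forall>q\<in>D. \<exists>r\<in>D. p \<sqsubseteq>\<^bsub>L\<^esub> r \<and> q \<sqsubseteq>\<^bsub>L\<^esub> r)"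

definition localizable_space :: "'b measure \<Rightarrow> bool" where
  "localizable_space M \<longleftrightarrow>
    semifinite_space M \<and>
    (\<forall>D. directed_subset (Linf_projections M) D \<longrightarrow>
      (\<exists>s. least (Linf_projections M) s (Upper (Linf_projections M) D)))"

definition decomposable_space :: "'b measure \<Rightarrow> bool" where
  "decomposable_space M \<longleftrightarrow>
    (\<exists>P. partition_on (space M) P \<and>
      (\<forall>X\<in>P. X \<in> sets M \<and> emeasure M X < \<infinity>) \<and>
      sets M = {E. E \<subseteq> space M \<and> (\<forall>X\<in>P. E \<inter> X \<in> sets M)} \<and>
      (\<forall>E\<in>sets M. emeasure M E = (\<Sum>\<^sub>\<infinity>X\<in>P. emeasure M (E \<inter> X))))"

definition radon_space :: "'b topology \<Rightarrow> 'b measure \<Rightarrow> bool" where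
  "radon_space T M \<longleftrightarrow>
    complete_measure M \<and>
    (\<forall>E\<subseteq>space M. (\<forall>F\<in>sets M. emeasure M F < \<infinity> \<longrightarrow> E \<inter> F \<in> sets M) \<longrightarrow> E \<in> sets M) \<and>
    topspace T = space M \<and> Hausdorff_space T \<and>
    (\<forall>U. openin T U \<longrightarrow> U \<in> sets M) \<and>
    (\<forall>E\<in>sets M. emeasure M E = (SUP C\<in>{C. C \<subseteq> E \<and> compactin T C}. emeasure M C)) \<and>
    (\<forall>x\<in>space M. \<exists>U. openin T U \<and> x \<in> U \<and> emeasure M U < \<infinity>)"

end

theory Submission
  imports Defs
begin

text \<open>
  Each condition is compared with one on a measure space \<open>M\<close>: it is semifinite and every
  family of measurable sets has a supremum modulo null sets. For the projections of \<open>L\<^sup>\<infinity>\<close>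
  this is clear, as they are the classes of indicator functions. In a decomposable space the
  supremum is glued from suprema over the pieces, each of which is a countable union because
  the piece has finite measure. A Radon space is decomposed by a maximal disjoint family of
  compact sets all of whose nonempty relatively open subsets have positive measure; a compact
  set meets only countably many of them, which yields measurability of arbitrary glued sets.

  Conversely, a localizable algebra is represented on the space \<open>X\<close> of those ultrafilters
  that contain an element of finite measure. For \<open>E \<subseteq> X\<close> consider the supremum \<open>i(E)\<close> of all
  clopen sets contained in \<open>E\<close>, taken in the algebra. The sets \<open>E\<close> with \<open>i(E) \<squnion> i(X - E) = 1\<close>
  form a \<open>\<sigma>\<close>-algebra, by weak \<open>\<sigma>\<close>-distributivity of semifinite measure algebras, and the measure of
  \<open>i(E)\<close> is a Radon measure on it whose algebra is the given one.
\<close>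

section \<open>Suprema modulo null sets\<close>

text \<open>A family of measurable sets may be uncountable. Its union need not be measurable, and
  even when it is, it may be larger than the supremum; so \<open>ess_sup\<close> asks for a least
  set modulo null sets. The relation \<open>presents\<close> lets one criterion serve projections,
  measure algebras of spaces and the abstract algebra alike.

  If the whole algebra has infinite measure, its full Stone space is compact and so must have a
  point all of whose clopen neighbourhoods have infinite measure. Keeping only ultrafilters with an
  element of finite measure removes such points, and semifiniteness leaves enough points to tell the
  elements of the algebra apart. On what remains, the supremum of a family of clopen sets is the
  closure of their union, so the part of the closure outside the union must be null, and the null
  sets are taken to be the nowhere dense sets. In any space these are closed under finite unions;
  here weak \<sigma>-distributivity gives countable unions as well.\<close>

definition ess_sup :: "'b measure \<Rightarrow> 'b set set \<Rightarrow> 'b set \<Rightarrow> bool" where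
  "ess_sup M D S \<longleftrightarrow> S \<in> sets M \<and> (\<forall>E\<in>D. E - S \<in> null_sets M) \<and>
    (\<forall>W\<in>sets M. (\<forall>E\<in>D. E - W \<in> null_sets M) \<longrightarrow> S - W \<in> null_sets M)"

definition ess_complete :: "'b measure \<Rightarrow> bool" where
  "ess_complete M \<longleftrightarrow> (\<forall>D\<subseteq>sets M. \<exists>S. ess_sup M D S)"

text \<open>\<open>c\<close> identifies \<open>L\<close> with the measurable sets modulo null sets.\<close>

definition presents :: "'b measure \<Rightarrow> 'a gorder \<Rightarrow> ('b set \<Rightarrow> 'a) \<Rightarrow> bool" where
  "presents M L c \<longleftrightarrow> c ` sets M = carrier L \<and>
    (\<forall>E\<in>sets M. \<forall>F\<in>sets M. c E \<sqsubseteq>\<^bsub>L\<^esub> c F \<longleftrightarrow> E - F \<in> null_sets M)"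

lemma presents_carrier: "presents M L c \<Longrightarrow> E \<in> sets M \<Longrightarrow> c E \<in> carrier L"
  unfolding presents_def by blast

lemma presents_le:
  "presents M L c \<Longrightarrow> E \<in> sets M \<Longrightarrow> F \<in> sets M \<Longrightarrow> c E \<sqsubseteq>\<^bsub>L\<^esub> c F \<longleftrightarrow> E - F \<in> null_sets M"
  unfolding presents_def by blast

lemma presents_Upper:
  assumes "presents M L c" "D \<subseteq> sets M"
  shows "Upper L (c ` D) = c ` {W \<in> sets M. \<forall>E\<in>D. E - W \<in> null_sets M}"
proof -
  have "carrier L = c ` sets M" using assms(1) by (simp add: presents_def)
  moreover have "(\<forall>x. x \<in> c ` D \<inter> carrier L \<longrightarrow> x \<sqsubseteq>\<^bsub>L\<^esub> c W) \<longleftrightarrow> (\<forall>E\<in>D. E - W \<in> null_sets M)"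
    if "W \<in> sets M" for W
    using presents_le[OF assms(1) _ that] presents_carrier[OF assms(1)] assms(2) by blast
  ultimately show ?thesis unfolding Upper_def by auto
qed

lemma presents_least:
  assumes p: "presents M L c" and D: "D \<subseteq> sets M" and S: "S \<in> sets M"
  shows "least L (c S) (Upper L (c ` D)) \<longleftrightarrow> ess_sup M D S"
proof -
  let ?U = "\<lambda>W. \<forall>E\<in>D. E - W \<in> null_sets M"
  \<comment> \<open>\<open>c\<close> need not be injective: membership of \<open>c S\<close> in the
    image only says that some \<open>W\<close> of the same class is an upper bound. This passes to
    \<open>S\<close> because the order depends on classes alone.\<close>
  have "?U S" if "W \<in> sets M" "?U W" "c S = c W" for W
    using that presents_le[OF p _ S] presents_le[OF p _ that(1)] D by auto
  then have "c S \<in> c ` {W \<in> sets M. ?U W} \<longleftrightarrow> ?U S"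
    using S by blast
  moreover have "c ` {W \<in> sets M. ?U W} \<subseteq> carrier L"
    using presents_carrier[OF p] by blast
  moreover have "(\<forall>x\<in>c ` {W \<in> sets M. ?U W}. c S \<sqsubseteq>\<^bsub>L\<^esub> x) \<longleftrightarrow>
      (\<forall>W\<in>sets M. ?U W \<longrightarrow> S - W \<in> null_sets M)"
    using presents_le[OF p S] by blast
  ultimately show ?thesis
    unfolding least_def presents_Upper[OF p D] ess_sup_def using S by blast
qed

lemma presents_has_sup:
  assumes p: "presents M L c" and D: "D \<subseteq> sets M"
  shows "(\<exists>s. least L s (Upper L (c ` D))) \<longleftrightarrow> (\<exists>S. ess_sup M D S)"
proof
  assume "\<exists>s. least L s (Upper L (c ` D))"
  then obtain s where s: "least L s (Upper L (c ` D))" ..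
  then have "s \<in> carrier L" unfolding least_def by blast
  then obtain S where "S \<in> sets M" "s = c S" using p unfolding presents_def by blast
  then show "\<exists>S. ess_sup M D S" using s presents_least[OF p D] by auto
next
  assume "\<exists>S. ess_sup M D S"
  then show "\<exists>s. least L s (Upper L (c ` D))"
    using presents_least[OF p D] by (auto simp: ess_sup_def)
qed

text \<open>Since \<open>c\<close> is onto, every subset of the carrier is the image of a family of
  measurable sets, so completeness can be tested on such families.\<close>

lemma presents_dedekind_complete:
  assumes p: "presents M L c"
  shows "dedekind_complete L \<longleftrightarrow> ess_complete M"
proof -
  have "(\<forall>D\<subseteq>carrier L. Q D) \<longleftrightarrow> (\<forall>D\<subseteq>sets M. Q (c ` D))" for Q
    by (metis assms presents_def subset_image_iff image_mono)
  then show ?thesis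
    unfolding dedekind_complete_def ess_complete_def by (simp add: presents_has_sup[OF p] cong: imp_cong)
qed

text \<open>Closing a family under finite unions makes it directed and leaves its upper bounds
  modulo null sets unchanged, so suprema of directed families already give all suprema.\<close>

lemma directed_complete_iff_ess_complete:
  assumes p: "presents M L c"
  shows "(\<forall>D. directed_subset L D \<longrightarrow> (\<exists>s. least L s (Upper L D))) \<longleftrightarrow> ess_complete M"
proof
  assume *: "\<forall>D. directed_subset L D \<longrightarrow> (\<exists>s. least L s (Upper L D))"
  show "ess_complete M" unfolding ess_complete_def
  proof (intro allI impI)
    fix D assume D: "D \<subseteq> sets M"
    \<comment> \<open>The empty union is allowed, so \<open>D'\<close> is nonempty even for empty
      \<open>D\<close>.\<close>
    define D' where "D' = {\<Union>F |F. finite F \<and> F \<subseteq> D}"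
    have D': "D' \<subseteq> sets M" using D by (auto simp: D'_def intro!: sets.finite_Union)
    have "directed_subset L (c ` D')"
      unfolding directed_subset_def
    proof (intro conjI ballI)
      show "c ` D' \<noteq> {}" by (auto simp: D'_def)
      show "c ` D' \<subseteq> carrier L" using D' presents_carrier[OF p] by auto
      fix x y assume "x \<in> c ` D'" "y \<in> c ` D'"
      then obtain F G where F: "finite F" "F \<subseteq> D" "x = c (\<Union>F)" and G: "finite G" "G \<subseteq> D" "y = c (\<Union>G)"
        by (auto simp: D'_def)
      have "\<Union>(F \<union> G) \<in> D'" using F G unfolding D'_def by blast
      moreover have "\<Union>F \<in> D'" "\<Union>G \<in> D'" using F G unfolding D'_def by blast+
      moreover have "\<Union>F - \<Union>(F \<union> G) = {}" "\<Union>G - \<Union>(F \<union> G) = {}" by auto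
      ultimately have "x \<sqsubseteq>\<^bsub>L\<^esub> c (\<Union>(F \<union> G))" "y \<sqsubseteq>\<^bsub>L\<^esub> c (\<Union>(F \<union> G))"
        using presents_le[OF p] D' F G by (metis null_sets.empty_sets subsetD)+
      then show "\<exists>r\<in>c ` D'. x \<sqsubseteq>\<^bsub>L\<^esub> r \<and> y \<sqsubseteq>\<^bsub>L\<^esub> r" using \<open>\<Union>(F \<union> G) \<in> D'\<close> by blast
    qed
    then obtain S where S: "ess_sup M D' S" using * presents_has_sup[OF p D'] by blast
    have "(\<forall>E\<in>D'. E - W \<in> null_sets M) \<longleftrightarrow> (\<forall>E\<in>D. E - W \<in> null_sets M)" for W
    proof
      assume "\<forall>E\<in>D'. E - W \<in> null_sets M"
      moreover have "E \<in> D'" if "E \<in> D" for E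
        using that unfolding D'_def by (intro CollectI exI[of _ "{E}"]) auto
      ultimately show "\<forall>E\<in>D. E - W \<in> null_sets M" by blast
    next
      assume W: "\<forall>E\<in>D. E - W \<in> null_sets M"
      show "\<forall>E\<in>D'. E - W \<in> null_sets M"
      proof
        fix E assume "E \<in> D'"
        then obtain F where F: "finite F" "F \<subseteq> D" "E = \<Union>F" by (auto simp: D'_def)
        then have "E - W = (\<Union>G\<in>F. G - W)" by auto
        then show "E - W \<in> null_sets M" using F W
          by (metis (no_types, lifting) countable_finite null_sets_UN' subsetD)
      qed
    qed
    then have "ess_sup M D S" using S by (simp add: ess_sup_def)
    then show "\<exists>S. ess_sup M D S" ..
  qed
next
  assume "ess_complete M"
  then have "dedekind_complete L" by (simp add: presents_dedekind_complete[OF p])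
  then show "\<forall>D. directed_subset L D \<longrightarrow> (\<exists>s. least L s (Upper L D))"
    by (simp add: dedekind_complete_def directed_subset_def)
qed


section \<open>Projections of \<open>L\<^sup>\<infinity>\<close>\<close>

lemma equiv_ae_rel: "equiv (ess_bounded_fun M) (ae_rel M)"
  unfolding equiv_def refl_on_def sym_def trans_def ae_rel_def by (auto elim: eventually_elim2)

lemma ae_class_eq_iff:
  "f \<in> ess_bounded_fun M \<Longrightarrow> g \<in> ess_bounded_fun M \<Longrightarrow>
    ae_rel M `` {f} = ae_rel M `` {g} \<longleftrightarrow> (AE x in M. f x = g x)"
  by (subst eq_equiv_class_iff[OF equiv_ae_rel]) (auto simp: ae_rel_def)

lemma ess_bounded_fun_mult:
  assumes "f \<in> ess_bounded_fun M" "g \<in> ess_bounded_fun M"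
  shows "(\<lambda>x. f x * g x) \<in> ess_bounded_fun M"
proof -
  obtain c d where c: "AE x in M. cmod (f x) \<le> c" and d: "AE x in M. cmod (g x) \<le> d"
    using assms by (auto simp: ess_bounded_fun_def)
  have "AE x in M. cmod (f x * g x) \<le> c * d"
    using c d
  proof eventually_elim
    case (elim x)
    then show ?case unfolding norm_mult
      by (intro mult_mono) (auto intro: order_trans[OF norm_ge_zero])
  qed
  then show ?thesis using assms by (auto simp: ess_bounded_fun_def)
qed

lemma ess_bounded_fun_cnj:
  "f \<in> ess_bounded_fun M \<Longrightarrow> (\<lambda>x. cnj (f x)) \<in> ess_bounded_fun M"
  by (auto simp: ess_bounded_fun_def intro!: borel_measurable_continuous_on[of cnj, unfolded o_def] continuous_intros)

text \<open>The product is a union over all representatives; it is a single class because every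
  choice of representatives yields the same one.\<close>

lemma Linf_mult_class:
  assumes f: "f \<in> ess_bounded_fun M" and g: "g \<in> ess_bounded_fun M"
  shows "Linf_mult M (ae_rel M `` {f}) (ae_rel M `` {g}) = ae_rel M `` {\<lambda>x. f x * g x}"
proof -
  have "ae_rel M `` {\<lambda>x. f' x * g' x} = ae_rel M `` {\<lambda>x. f x * g x}"
    if "f' \<in> ae_rel M `` {f}" "g' \<in> ae_rel M `` {g}" for f' g'
  proof -
    have *: "f' \<in> ess_bounded_fun M" "g' \<in> ess_bounded_fun M" "AE x in M. f x = f' x" "AE x in M. g x = g' x"
      using that by (auto simp: ae_rel_def)
    from *(3,4) have "AE x in M. f' x * g' x = f x * g x" by eventually_elim auto
    then show ?thesis using * f g by (subst ae_class_eq_iff) (auto intro: ess_bounded_fun_mult)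
  qed
  moreover have "f \<in> ae_rel M `` {f}" "g \<in> ae_rel M `` {g}" using f g by (auto simp: ae_rel_def)
  ultimately show ?thesis unfolding Linf_mult_def by blast
qed

lemma Linf_star_class:
  assumes f: "f \<in> ess_bounded_fun M"
  shows "Linf_star M (ae_rel M `` {f}) = ae_rel M `` {\<lambda>x. cnj (f x)}"
proof -
  have "ae_rel M `` {\<lambda>x. cnj (f' x)} = ae_rel M `` {\<lambda>x. cnj (f x)}"
    if "f' \<in> ae_rel M `` {f}" for f'
  proof -
    have *: "f' \<in> ess_bounded_fun M" "AE x in M. f x = f' x"
      using that by (auto simp: ae_rel_def)
    from *(2) have "AE x in M. cnj (f' x) = cnj (f x)" by eventually_elim auto
    then show ?thesis using * f by (subst ae_class_eq_iff) (auto intro: ess_bounded_fun_cnj)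
  qed
  moreover have "f \<in> ae_rel M `` {f}" using f by (auto simp: ae_rel_def)
  ultimately show ?thesis unfolding Linf_star_def by blast
qed

lemma indicator_ess_bounded_fun:
  "E \<in> sets M \<Longrightarrow> (indicator E :: _ \<Rightarrow> complex) \<in> ess_bounded_fun M"
  unfolding ess_bounded_fun_def by (auto intro!: exI[of _ 1] simp: indicator_def)

lemma AE_indicator_eq_iff:
  assumes "E \<in> sets M" "F \<in> sets M"
  shows "(AE x in M. indicator E x * indicator F x = (indicator E x :: complex)) \<longleftrightarrow> E - F \<in> null_sets M"
proof -
  have "E - F \<in> null_sets M \<longleftrightarrow> (AE x in M. x \<notin> E - F)"
    using assms by (intro AE_iff_null_sets) auto
  also have "\<dots> \<longleftrightarrow> (AE x in M. indicator E x * indicator F x = (indicator E x :: complex))"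
    by (intro AE_cong) (auto simp: indicator_def)
  finally show ?thesis ..
qed

text \<open>An idempotent class satisfies \<open>f x * f x = f x\<close> almost everywhere, so
  \<open>f\<close> is almost everywhere 0 or 1 and agrees there with the indicator of the set where
  it is 1. The order \<open>p q = p\<close> then says that \<open>E - F\<close> is null.\<close>

lemma presents_Linf_projections:
  "presents M (Linf_projections M) (\<lambda>E. ae_rel M `` {indicator E})"
  unfolding presents_def
proof (intro conjI ballI)
  show "(\<lambda>E. ae_rel M `` {indicator E}) ` sets M = carrier (Linf_projections M)"
  proof (intro subset_antisym subsetI)
    fix p assume "p \<in> (\<lambda>E. ae_rel M `` {indicator E}) ` sets M"
    then obtain E where E: "E \<in> sets M" "p = ae_rel M `` {indicator E}" by auto
    note ind = indicator_ess_bounded_fun[OF E(1)]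
    have "(\<lambda>x. cnj (indicator E x)) = (indicator E :: _ \<Rightarrow> complex)"
      "(\<lambda>x. indicator E x * indicator E x) = (indicator E :: _ \<Rightarrow> complex)"
      by (auto simp: indicator_def)
    then show "p \<in> carrier (Linf_projections M)"
      using ind by (auto simp: Linf_projections_def E(2) Linf_def quotientI Linf_mult_class Linf_star_class)
  next
    fix p assume p: "p \<in> carrier (Linf_projections M)"
    then obtain f where f: "f \<in> ess_bounded_fun M" "p = ae_rel M `` {f}"
      by (auto simp: Linf_projections_def Linf_def elim: quotientE)
    have "Linf_mult M p p = p" using p by (simp add: Linf_projections_def)
    then have ae: "AE x in M. f x * f x = f x"
      unfolding f(2) Linf_mult_class[OF f(1) f(1)] using f(1)
      by (subst (asm) ae_class_eq_iff) (auto intro: ess_bounded_fun_mult)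
    have [measurable]: "f \<in> borel_measurable M" using f(1) by (simp add: ess_bounded_fun_def)
    define E where "E = {x \<in> space M. f x = 1}"
    have E: "E \<in> sets M" unfolding E_def by measurable
    have "AE x in M. f x = indicator E x"
      using ae by (rule AE_mp) (auto simp: E_def indicator_def intro!: AE_I2)
    then have "p = ae_rel M `` {indicator E}"
      unfolding f(2) using f(1) indicator_ess_bounded_fun[OF E] by (subst ae_class_eq_iff)
    then show "p \<in> (\<lambda>E. ae_rel M `` {indicator E}) ` sets M" using E by blast
  qed
next
  fix E F assume EF: "E \<in> sets M" "F \<in> sets M"
  note ind = indicator_ess_bounded_fun[OF EF(1)] indicator_ess_bounded_fun[OF EF(2)]
  have "(ae_rel M `` {indicator E} \<sqsubseteq>\<^bsub>Linf_projections M\<^esub> ae_rel M `` {indicator F}) \<longleftrightarrow>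
      (AE x in M. indicator E x * indicator F x = (indicator E x :: complex))"
    by (simp add: Linf_projections_def Linf_mult_class ind ae_class_eq_iff ess_bounded_fun_mult)
  then show "(ae_rel M `` {indicator E} \<sqsubseteq>\<^bsub>Linf_projections M\<^esub> ae_rel M `` {indicator F}) \<longleftrightarrow>
      E - F \<in> null_sets M"
    unfolding AE_indicator_eq_iff[OF EF] .
qed

lemma localizable_space_iff:
  "localizable_space M \<longleftrightarrow> semifinite_space M \<and> ess_complete M"
  unfolding localizable_space_def
  by (simp add: directed_complete_iff_ess_complete[OF presents_Linf_projections])


section \<open>Decomposable spaces\<close>

text \<open>Exhaustion: a countable \<open>C'\<close> attains the supremum of the measures of
  countable unions inside \<open>X\<close>. Adding one more member cannot increase that measure, and
  since it is finite the new part is null.\<close>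

lemma countable_subfamily_ess_sup:
  assumes X: "X \<in> sets M" "emeasure M X < \<infinity>" and D: "D \<subseteq> sets M"
  shows "\<exists>C\<subseteq>D. countable C \<and> (\<forall>E\<in>D. (E - \<Union>C) \<inter> X \<in> null_sets M)"
proof -
  define Q where "Q = (\<lambda>C. emeasure M (\<Union>C \<inter> X)) ` {C. C \<subseteq> D \<and> countable C}"
  have "Q \<noteq> {}" by (auto simp: Q_def)
  from ennreal_Sup_countable_SUP[OF this]
  obtain f :: "nat \<Rightarrow> ennreal" where f: "range f \<subseteq> Q" "Sup Q = (SUP i. f i)" by blast
  have "\<forall>n::nat. \<exists>C. C \<subseteq> D \<and> countable C \<and> f n = emeasure M (\<Union>C \<inter> X)"
    using f(1) unfolding Q_def by (auto simp: image_subset_iff image_iff)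
  then obtain C where C: "\<And>n. C n \<subseteq> D" "\<And>n. countable (C n)" "\<And>n. f n = emeasure M (\<Union>(C n) \<inter> X)"
    by metis
  define C' where "C' = (\<Union>n. C n)"
  have C': "C' \<subseteq> D" "countable C'" using C(1,2) by (auto simp: C'_def)
  have U: "\<Union>K \<in> sets M" if "K \<subseteq> D" "countable K" for K
    using that D by (intro sets.countable_Union) auto
  have "Sup Q \<le> emeasure M (\<Union>C' \<inter> X)"
    unfolding f(2) C(3) using U[OF C'] X
    by (intro SUP_least emeasure_mono) (auto simp: C'_def)
  moreover have le: "emeasure M (\<Union>K \<inter> X) \<le> Sup Q" if "K \<subseteq> D" "countable K" for K
    using that by (intro Sup_upper) (auto simp: Q_def)
  ultimately have *: "emeasure M (\<Union>K \<inter> X) \<le> emeasure M (\<Union>C' \<inter> X)" if "K \<subseteq> D" "countable K" for K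
    using that by (meson order_trans)
  have "(E - \<Union>C') \<inter> X \<in> null_sets M" if "E \<in> D" for E
  proof -
    have E: "E \<in> sets M" using that D by auto
    have "emeasure M (\<Union>(insert E C') \<inter> X) \<le> emeasure M (\<Union>C' \<inter> X)"
      using that C' by (intro *) auto
    moreover have "\<Union>(insert E C') \<inter> X = (\<Union>C' \<inter> X) \<union> ((E - \<Union>C') \<inter> X)" by auto
    moreover have "emeasure M ((\<Union>C' \<inter> X) \<union> ((E - \<Union>C') \<inter> X)) =
        emeasure M (\<Union>C' \<inter> X) + emeasure M ((E - \<Union>C') \<inter> X)"
      using U[OF C'] E X by (intro plus_emeasure[symmetric]) auto
    moreover have "emeasure M (\<Union>C' \<inter> X) \<le> emeasure M X"
      using X by (intro emeasure_mono) auto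
    then have "emeasure M (\<Union>C' \<inter> X) \<noteq> \<infinity>" using X(2) by auto
    ultimately have "emeasure M (\<Union>C' \<inter> X) + emeasure M ((E - \<Union>C') \<inter> X) \<le> emeasure M (\<Union>C' \<inter> X) + 0"
      by (simp only: add_0_right)
    then have "emeasure M ((E - \<Union>C') \<inter> X) = 0"
      using \<open>emeasure M (\<Union>C' \<inter> X) \<noteq> \<infinity>\<close> by (subst (asm) ennreal_add_left_cancel_le) auto
    then show ?thesis using U[OF C'] E X by (auto intro!: null_setsI)
  qed
  then show ?thesis using C' by blast
qed

lemma decomposable_space_localizable:
  assumes "decomposable_space M"
  shows "semifinite_space M" and "ess_complete M"
proof -
  obtain P where P: "partition_on (space M) P" "\<forall>X\<in>P. X \<in> sets M \<and> emeasure M X < \<infinity>"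
      and sets: "sets M = {E. E \<subseteq> space M \<and> (\<forall>X\<in>P. E \<inter> X \<in> sets M)}"
      and em: "\<forall>E\<in>sets M. emeasure M E = (\<Sum>\<^sub>\<infinity>X\<in>P. emeasure M (E \<inter> X))"
    using assms unfolding decomposable_space_def by (elim exE conjE) (rule that)
  have Ps: "X \<in> sets M" and Pf: "emeasure M X < \<infinity>" if "X \<in> P" for X
    using P(2) that by auto
  \<comment> \<open>There may be uncountably many pieces; a set null on each of them is null since
    its measure is a sum of zeros.\<close>
  have null: "E \<in> null_sets M" if "E \<in> sets M" "\<And>X. X \<in> P \<Longrightarrow> E \<inter> X \<in> null_sets M" for E
    using that by (intro null_setsI) (auto simp: em[rule_format] intro!: infsum_0)
  show "semifinite_space M" unfolding semifinite_space_def
  proof (intro ballI impI)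
    fix E assume E: "E \<in> sets M" "emeasure M E = \<infinity>"
    then have "E \<notin> null_sets M" by auto
    then obtain X where X: "X \<in> P" "E \<inter> X \<notin> null_sets M" using null E(1) by blast
    have "emeasure M (E \<inter> X) \<le> emeasure M X" using E X Ps by (intro emeasure_mono) auto
    then have "emeasure M (E \<inter> X) < \<infinity>" using Pf[OF X(1)] by auto
    moreover have "emeasure M (E \<inter> X) > 0" using X E Ps by (metis null_setsI sets.Int zero_less_iff_neq_zero)
    ultimately show "\<exists>F\<in>sets M. F \<subseteq> E \<and> 0 < emeasure M F \<and> emeasure M F < \<infinity>"
      using E X Ps by (intro bexI[of _ "E \<inter> X"]) auto
  qed
  show "ess_complete M" unfolding ess_complete_def
  proof (intro allI impI)
    fix D assume D: "D \<subseteq> sets M"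
    have "\<forall>X\<in>P. \<exists>C\<subseteq>D. countable C \<and> (\<forall>E\<in>D. (E - \<Union>C) \<inter> X \<in> null_sets M)"
      using countable_subfamily_ess_sup[OF Ps Pf D] by blast
    then obtain C where C: "\<And>X. X \<in> P \<Longrightarrow> C X \<subseteq> D" "\<And>X. X \<in> P \<Longrightarrow> countable (C X)"
        "\<And>X E. X \<in> P \<Longrightarrow> E \<in> D \<Longrightarrow> (E - \<Union>(C X)) \<inter> X \<in> null_sets M" by metis
    \<comment> \<open>The countable family depends on the piece, so \<open>S\<close> may be an
      uncountable union. It is measurable because only its traces on the pieces count.\<close>
    define S where "S = (\<Union>X\<in>P. \<Union>(C X) \<inter> X)"
    have S_Int: "S \<inter> X = \<Union>(C X) \<inter> X" if "X \<in> P" for X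
    proof -
      have "X \<inter> Y = {}" if "Y \<in> P" "Y \<noteq> X" for Y
        using P(1) \<open>X \<in> P\<close> that by (auto simp: partition_on_def disjoint_def)
      then show ?thesis using that unfolding S_def by blast
    qed
    have UC: "\<Union>(C X) \<in> sets M" if "X \<in> P" for X
      using C(1,2)[OF that] D by (intro sets.countable_Union) auto
    have S: "S \<in> sets M"
    proof (subst sets, intro CollectI conjI ballI)
      show "S \<subseteq> space M" unfolding S_def using Ps[THEN sets.sets_into_space] by auto
      show "S \<inter> X \<in> sets M" if "X \<in> P" for X using UC[OF that] Ps[OF that] S_Int[OF that] by auto
    qed
    have "ess_sup M D S" unfolding ess_sup_def
    proof (intro conjI ballI impI)
      fix E assume E: "E \<in> D"
      show "E - S \<in> null_sets M"
      proof (rule null)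
        show "E - S \<in> sets M" using E D S by auto
        fix X assume X: "X \<in> P"
        have "(E - S) \<inter> X = (E - \<Union>(C X)) \<inter> X" using S_Int[OF X] by blast
        then show "(E - S) \<inter> X \<in> null_sets M" using C(3)[OF X E] by simp
      qed
    next
      fix W assume W: "W \<in> sets M" "\<forall>E\<in>D. E - W \<in> null_sets M"
      show "S - W \<in> null_sets M"
      proof (rule null)
        show "S - W \<in> sets M" using W S by auto
        fix X assume X: "X \<in> P"
        have "(S - W) \<inter> X = (\<Union>E\<in>C X. E - W) \<inter> X" using S_Int[OF X] by blast
        moreover have "(\<Union>E\<in>C X. E - W) \<in> null_sets M"
          using C(1,2)[OF X] W by (intro null_sets_UN') auto
        ultimately show "(S - W) \<inter> X \<in> null_sets M"
          using null_set_Int2[OF _ Ps[OF X]] by simp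
      qed
    qed (fact S)
    then show "\<exists>S. ess_sup M D S" ..
  qed
qed


section \<open>Order isomorphisms and the algebra of a measure space\<close>

lemma (in partial_order) sup_eqI: "least L s (Upper L D) \<Longrightarrow> \<Squnion>D = s"
  unfolding sup_def by (rule some_equality) (auto intro: least_unique)

lemma (in partial_order) inf_eqI: "greatest L s (Lower L D) \<Longrightarrow> \<Sqinter>D = s"
  unfolding inf_def by (rule some_equality) (auto intro: greatest_unique)

lemma Upper_image_iso:
  assumes "bij_betw \<pi> (carrier L) (carrier L')" "D \<subseteq> carrier L"
    and "\<And>p q. p \<in> carrier L \<Longrightarrow> q \<in> carrier L \<Longrightarrow> \<pi> p \<sqsubseteq>\<^bsub>L'\<^esub> \<pi> q \<longleftrightarrow> p \<sqsubseteq>\<^bsub>L\<^esub> q"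
  shows "Upper L' (\<pi> ` D) = \<pi> ` Upper L D"
proof -
  have c: "carrier L' = \<pi> ` carrier L" using assms(1) by (simp add: bij_betw_def)
  have "Upper L' (\<pi> ` D) = {u \<in> \<pi> ` carrier L. \<forall>x\<in>D. \<pi> x \<sqsubseteq>\<^bsub>L'\<^esub> u}"
    unfolding Upper_def c using assms(2) by blast
  also have "\<dots> = \<pi> ` {u \<in> carrier L. \<forall>x\<in>D. \<pi> x \<sqsubseteq>\<^bsub>L'\<^esub> \<pi> u}" by auto
  also have "{u \<in> carrier L. \<forall>x\<in>D. \<pi> x \<sqsubseteq>\<^bsub>L'\<^esub> \<pi> u} = {u \<in> carrier L. \<forall>x\<in>D. x \<sqsubseteq>\<^bsub>L\<^esub> u}"
    by (intro Collect_cong conj_cong refl ball_cong assms(3)) (use assms(2) in blast)+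
  also have "\<dots> = Upper L D" unfolding Upper_def using assms(2) by blast
  finally show ?thesis .
qed

lemma Lower_image_iso:
  assumes "bij_betw \<pi> (carrier L) (carrier L')" "D \<subseteq> carrier L"
    and "\<And>p q. p \<in> carrier L \<Longrightarrow> q \<in> carrier L \<Longrightarrow> \<pi> p \<sqsubseteq>\<^bsub>L'\<^esub> \<pi> q \<longleftrightarrow> p \<sqsubseteq>\<^bsub>L\<^esub> q"
  shows "Lower L' (\<pi> ` D) = \<pi> ` Lower L D"
proof -
  have c: "carrier L' = \<pi> ` carrier L" using assms(1) by (simp add: bij_betw_def)
  have "Lower L' (\<pi> ` D) = {u \<in> \<pi> ` carrier L. \<forall>x\<in>D. u \<sqsubseteq>\<^bsub>L'\<^esub> \<pi> x}"
    unfolding Lower_def c using assms(2) by blast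
  also have "\<dots> = \<pi> ` {u \<in> carrier L. \<forall>x\<in>D. \<pi> u \<sqsubseteq>\<^bsub>L'\<^esub> \<pi> x}" by auto
  also have "{u \<in> carrier L. \<forall>x\<in>D. \<pi> u \<sqsubseteq>\<^bsub>L'\<^esub> \<pi> x} = {u \<in> carrier L. \<forall>x\<in>D. u \<sqsubseteq>\<^bsub>L\<^esub> x}"
    by (intro Collect_cong conj_cong refl ball_cong assms(3)) (use assms(2) in blast)+
  also have "\<dots> = Lower L D" unfolding Lower_def using assms(2) by blast
  finally show ?thesis .
qed

text \<open>Joins, meets and bounds are determined by the order. Those of \<open>L'\<close> are
  found as images of those of \<open>L\<close>, so \<open>malg M\<close> need only be known to be a
  partial order.\<close>

lemma boolean_isoI:
  assumes L: "bounded_lattice L" and L': "partial_order L'"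
    and bij: "bij_betw \<pi> (carrier L) (carrier L')"
    and le: "\<And>p q. p \<in> carrier L \<Longrightarrow> q \<in> carrier L \<Longrightarrow> \<pi> p \<sqsubseteq>\<^bsub>L'\<^esub> \<pi> q \<longleftrightarrow> p \<sqsubseteq>\<^bsub>L\<^esub> q"
  shows "boolean_iso L L' \<pi>"
proof -
  interpret L: bounded_lattice L by fact
  interpret L': partial_order L' by fact
  note U = Upper_image_iso[OF bij _ le] and Lo = Lower_image_iso[OF bij _ le]
  have im: "\<pi> ` carrier L = carrier L'" using bij by (simp add: bij_betw_def)
  have least: "least L' (\<pi> s) (\<pi> ` B)" if "least L s B" for s B
  proof -
    have "B \<subseteq> carrier L" using that by (simp add: least_def)
    then show ?thesis using that unfolding least_def im[symmetric]
      by (auto simp: le subset_iff)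
  qed
  have greatest: "greatest L' (\<pi> s) (\<pi> ` B)" if "greatest L s B" for s B
  proof -
    have "B \<subseteq> carrier L" using that by (simp add: greatest_def)
    then show ?thesis using that unfolding greatest_def im[symmetric]
      by (auto simp: le subset_iff)
  qed
  have "\<pi> (p \<squnion>\<^bsub>L\<^esub> q) = \<pi> p \<squnion>\<^bsub>L'\<^esub> \<pi> q" if pq: "p \<in> carrier L" "q \<in> carrier L" for p q
  proof -
    obtain s where s: "least L s (Upper L {p, q})" using L.sup_of_two_exists[OF pq] ..
    have "least L' (\<pi> s) (Upper L' {\<pi> p, \<pi> q})"
      using least[OF s] U[of "{p, q}"] pq by simp
    then show ?thesis using s by (simp add: join_def L.sup_eqI L'.sup_eqI)
  qed
  moreover have "\<pi> (p \<sqinter>\<^bsub>L\<^esub> q) = \<pi> p \<sqinter>\<^bsub>L'\<^esub> \<pi> q" if pq: "p \<in> carrier L" "q \<in> carrier L" for p q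
  proof -
    obtain s where s: "greatest L s (Lower L {p, q})" using L.inf_of_two_exists[OF pq] ..
    have "greatest L' (\<pi> s) (Lower L' {\<pi> p, \<pi> q})"
      using greatest[OF s] Lo[of "{p, q}"] pq by simp
    then show ?thesis using s by (simp add: meet_def L.inf_eqI L'.inf_eqI)
  qed
  moreover have "\<pi> \<bottom>\<^bsub>L\<^esub> = \<bottom>\<^bsub>L'\<^esub>"
  proof -
    have "least L' (\<pi> \<bottom>\<^bsub>L\<^esub>) (carrier L')" using least[OF L.bottom_least] im by simp
    then show ?thesis unfolding bottom_def[of L']
      by (intro some_equality[symmetric]) (auto intro: L'.least_unique)
  qed
  moreover have "\<pi> \<top>\<^bsub>L\<^esub> = \<top>\<^bsub>L'\<^esub>"
  proof -
    have "greatest L' (\<pi> \<top>\<^bsub>L\<^esub>) (carrier L')" using greatest[OF L.top_greatest] im by simp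
    then show ?thesis unfolding top_def[of L']
      by (intro some_equality[symmetric]) (auto intro: L'.greatest_unique)
  qed
  ultimately show ?thesis using bij by (simp add: boolean_iso_def)
qed

text \<open>An isomorphism is only assumed to respect the lattice operations, so the order must be
  recovered from joins. This computes them, the union being an essential supremum of the two
  sets.\<close>

lemma presents_join:
  assumes p: "presents M L c" and L: "partial_order L" and EF: "E \<in> sets M" "F \<in> sets M"
  shows "c E \<squnion>\<^bsub>L\<^esub> c F = c (E \<union> F)"
proof -
  have "E - (E \<union> F) \<in> null_sets M" "F - (E \<union> F) \<in> null_sets M"
    by (metis Diff_eq_empty_iff Un_upper1 Un_upper2 null_sets.empty_sets)+
  then have "ess_sup M {E, F} (E \<union> F)"
    unfolding ess_sup_def using EF by (auto simp: Un_Diff)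
  then have "least L (c (E \<union> F)) (Upper L (c ` {E, F}))"
    using EF by (subst presents_least[OF p]) auto
  then show ?thesis unfolding join_def by (intro partial_order.sup_eqI[OF L]) simp
qed

section \<open>Classes modulo null sets\<close>

lemma null_Diff_trans:
  assumes "E - F \<in> null_sets M" "F - G \<in> null_sets M" "E \<in> sets M" "G \<in> sets M"
  shows "E - G \<in> null_sets M"
  by (rule null_sets_subset[of "(E - F) \<union> (F - G)"]) (use assms in auto)

lemma equiv_null_rel: "equiv (sets M) (null_rel M)"
proof -
  have *: "null_rel M = {(E, F). E \<in> sets M \<and> F \<in> sets M \<and> E - F \<in> null_sets M \<and> F - E \<in> null_sets M}"
    unfolding null_rel_def by (auto intro: null_sets_subset)
  show ?thesis
    unfolding * equiv_def refl_on_def sym_def trans_def by (auto intro: null_Diff_trans)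
qed

lemma null_rel_class:
  "F \<in> null_rel M `` {E} \<longleftrightarrow>
    E \<in> sets M \<and> F \<in> sets M \<and> E - F \<in> null_sets M \<and> F - E \<in> null_sets M"
  unfolding null_rel_def by (auto intro: null_sets_subset)

text \<open>The order on classes asks for one good pair of representatives. Passing to another pair
  changes the difference by null sets only, so any pair will do.\<close>

lemma presents_malg: "presents M (malg M) (\<lambda>E. null_rel M `` {E})"
  unfolding presents_def
proof (intro conjI ballI)
  show "(\<lambda>E. null_rel M `` {E}) ` sets M = carrier (malg M)"
    by (auto simp: malg_def quotient_def)
  fix E F assume EF: "E \<in> sets M" "F \<in> sets M"
  have "E - F \<in> null_sets M"
    if "E' \<in> null_rel M `` {E}" "F' \<in> null_rel M `` {F}" "E' - F' \<in> null_sets M" for E' F'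
    using that unfolding null_rel_class by (metis null_Diff_trans)
  moreover have "E \<in> null_rel M `` {E}" "F \<in> null_rel M `` {F}"
    using EF by (simp_all add: null_rel_class del: Image_singleton_iff)
  ultimately show "(null_rel M `` {E} \<sqsubseteq>\<^bsub>malg M\<^esub> null_rel M `` {F}) \<longleftrightarrow> E - F \<in> null_sets M"
    by (auto simp: malg_def simp del: Image_singleton_iff)
qed

lemma partial_order_malg: "partial_order (malg M)"
proof -
  note p = presents_malg[of M]
  have obt: "\<exists>E\<in>sets M. P = null_rel M `` {E}" if "P \<in> carrier (malg M)" for P
    using that p unfolding presents_def by (metis (no_types, lifting) imageE)
  have eq: "(.=\<^bsub>malg M\<^esub>) = (=)" by (simp add: malg_def)
  show ?thesis
  proof (unfold_locales, simp_all add: eq)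
    fix x assume "x \<in> carrier (malg M)"
    then show "x \<sqsubseteq>\<^bsub>malg M\<^esub> x" using obt presents_le[OF p] by fastforce
  next
    fix x y assume "x \<sqsubseteq>\<^bsub>malg M\<^esub> y" "y \<sqsubseteq>\<^bsub>malg M\<^esub> x" "x \<in> carrier (malg M)" "y \<in> carrier (malg M)"
    moreover from this obtain E F where "E \<in> sets M" "F \<in> sets M"
      "x = null_rel M `` {E}" "y = null_rel M `` {F}" using obt by meson
    ultimately have "F \<in> null_rel M `` {E}" and "y = null_rel M `` {F}" "x = null_rel M `` {E}"
      by (auto simp: null_rel_class presents_le[OF p] simp del: Image_singleton_iff)
    then show "x = y" using equiv_class_eq[OF equiv_null_rel, of E F] by auto
  next
    fix x y z assume "x \<sqsubseteq>\<^bsub>malg M\<^esub> y" "y \<sqsubseteq>\<^bsub>malg M\<^esub> z"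
      "x \<in> carrier (malg M)" "y \<in> carrier (malg M)" "z \<in> carrier (malg M)"
    moreover from this obtain E F G where "E \<in> sets M" "F \<in> sets M" "G \<in> sets M"
      "x = null_rel M `` {E}" "y = null_rel M `` {F}" "z = null_rel M `` {G}" using obt by meson
    ultimately show "x \<sqsubseteq>\<^bsub>malg M\<^esub> z"
      by (simp add: presents_le[OF p]) (metis null_Diff_trans)
  qed
qed

text \<open>\<open>the_elem\<close> is meaningful because equivalent sets have equal measure:
  \<open>F \<union> (E - F) = E \<union> (F - E)\<close>, and both added parts are null.\<close>

lemma malg_measure_class:
  assumes "E \<in> sets M"
  shows "malg_measure M (null_rel M `` {E}) = emeasure M E"
proof -
  have "emeasure M F = emeasure M E" if "F \<in> null_rel M `` {E}" for F
  proof -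
    have *: "F \<in> sets M" "E - F \<in> null_sets M" "F - E \<in> null_sets M"
      using that unfolding null_rel_class by auto
    have "emeasure M F = emeasure M (F \<union> (E - F))"
      using * by (intro emeasure_Un_null_set[symmetric])
    also have "F \<union> (E - F) = E \<union> (F - E)" by auto
    also have "emeasure M \<dots> = emeasure M E"
      using * assms by (intro emeasure_Un_null_set)
    finally show ?thesis .
  qed
  moreover have "E \<in> null_rel M `` {E}"
    using assms by (simp add: null_rel_class del: Image_singleton_iff)
  ultimately have "emeasure M ` (null_rel M `` {E}) = {emeasure M E}" by blast
  then show ?thesis by (simp add: malg_measure_def)
qed

text \<open>Composing the class map with the inverse of the isomorphism presents \<open>A\<close>
  itself, so that \<open>presents_dedekind_complete\<close> applies to \<open>A\<close>
  directly.\<close>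

lemma malg_isomorphic_presents:
  assumes A: "bounded_lattice A" and iso: "malg_isomorphic A \<mu> (malg M) (malg_measure M)"
  obtains c where "presents M A c" "\<And>E. E \<in> sets M \<Longrightarrow> \<mu> (c E) = emeasure M E"
proof -
  interpret A: bounded_lattice A by fact
  note p = presents_malg[of M]
  obtain \<pi> where \<pi>: "boolean_iso A (malg M) \<pi>" "\<And>p. p \<in> carrier A \<Longrightarrow> malg_measure M (\<pi> p) = \<mu> p"
    using iso unfolding malg_isomorphic_def by blast
  have bij: "bij_betw \<pi> (carrier A) (carrier (malg M))" using \<pi>(1) by (simp add: boolean_iso_def)
  define c where "c E = inv_into (carrier A) \<pi> (null_rel M `` {E})" for E
  have c: "c E \<in> carrier A" "\<pi> (c E) = null_rel M `` {E}" if "E \<in> sets M" for E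
    using presents_carrier[OF p that] bij unfolding c_def bij_betw_def
    by (metis inv_into_into, metis f_inv_into_f)
  have inj: "\<pi> x = \<pi> y \<longleftrightarrow> x = y" if "x \<in> carrier A" "y \<in> carrier A" for x y
    using bij that by (auto simp: bij_betw_def inj_on_eq_iff)
  have sub: "F - (E \<union> F) \<in> null_sets M" for E F
    by (metis Diff_eq_empty_iff Un_upper2 null_sets.empty_sets)
  have ceq: "null_rel M `` {E} = null_rel M `` {F} \<longleftrightarrow> E - F \<in> null_sets M \<and> F - E \<in> null_sets M"
    if "E \<in> sets M" "F \<in> sets M" for E F
    using eq_equiv_class_iff[OF equiv_null_rel that] null_rel_class[of F M E] that by auto
  have "presents M A c" unfolding presents_def
  proof (intro conjI ballI)
    show "c ` sets M = carrier A"
    proof (intro subset_antisym subsetI)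
      fix a assume a: "a \<in> carrier A"
      then have "\<pi> a \<in> carrier (malg M)" using bij by (auto simp: bij_betw_def)
      then obtain E where "E \<in> sets M" "\<pi> a = null_rel M `` {E}"
        using p unfolding presents_def by (metis (no_types, lifting) imageE)
      then show "a \<in> c ` sets M" using inj[OF a c(1)] c(2) by (metis imageI)
    qed (use c in auto)
    fix E F assume EF: "E \<in> sets M" "F \<in> sets M"
    \<comment> \<open>The order is rewritten through joins, the form that \<open>\<pi>\<close>
      transports.\<close>
    have "c E \<sqsubseteq>\<^bsub>A\<^esub> c F \<longleftrightarrow> c E \<squnion>\<^bsub>A\<^esub> c F = c F"
      using c EF by (simp add: A.le_iff_meet A.weak_le_iff_join A.eq_is_equal)
    also have "\<dots> \<longleftrightarrow> \<pi> (c E \<squnion>\<^bsub>A\<^esub> c F) = \<pi> (c F)"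
      using c(1) EF by (simp add: inj)
    also have "\<dots> \<longleftrightarrow> null_rel M `` {E} \<squnion>\<^bsub>malg M\<^esub> null_rel M `` {F} = null_rel M `` {F}"
      using \<pi>(1) c EF by (simp add: boolean_iso_def)
    also have "\<dots> \<longleftrightarrow> null_rel M `` {E \<union> F} = null_rel M `` {F}"
      by (simp add: presents_join[OF p partial_order_malg EF])
    also have "\<dots> \<longleftrightarrow> E - F \<in> null_sets M"
      using ceq[of "E \<union> F" F] EF sub[of F E]
      by (simp add: Un_Diff del: Diff_eq_empty_iff)
    finally show "c E \<sqsubseteq>\<^bsub>A\<^esub> c F \<longleftrightarrow> E - F \<in> null_sets M" .
  qed
  moreover have "\<mu> (c E) = emeasure M E" if "E \<in> sets M" for E
    using \<pi>(2)[OF c(1)[OF that]] c(2)[OF that] malg_measure_class[OF that] by simp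
  ultimately show ?thesis by (rule that)
qed

lemma malg_localizable_iff:
  assumes A: "measure_algebra A \<mu>" and iso: "malg_isomorphic A \<mu> (malg M) (malg_measure M)"
  shows "malg_localizable A \<mu> \<longleftrightarrow> semifinite_space M \<and> ess_complete M"
proof -
  interpret A: measure_algebra A \<mu> by fact
  obtain c where p: "presents M A c" and c: "\<And>E. E \<in> sets M \<Longrightarrow> \<mu> (c E) = emeasure M E"
    using malg_isomorphic_presents[OF A.bounded_lattice_axioms iso] by blast
  have bot: "c E \<noteq> \<bottom>\<^bsub>A\<^esub> \<longleftrightarrow> 0 < emeasure M E" if "E \<in> sets M" for E
    using A.measure_zero_iff[OF presents_carrier[OF p that]] c[OF that]
    by (simp add: zero_less_iff_neq_zero)
  have im: "carrier A = c ` sets M" using p by (simp add: presents_def)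
  have "malg_semifinite A \<mu> \<longleftrightarrow> (\<forall>E\<in>sets M. 0 < emeasure M E \<longrightarrow>
      (\<exists>F\<in>sets M. 0 < emeasure M F \<and> F - E \<in> null_sets M \<and> emeasure M F < \<infinity>))"
    unfolding malg_semifinite_def im by (simp add: bot c presents_le[OF p])
  also have "\<dots> \<longleftrightarrow> semifinite_space M" unfolding semifinite_space_def
  proof (intro iffI ballI impI)
    fix E assume *: "\<forall>E\<in>sets M. 0 < emeasure M E \<longrightarrow>
      (\<exists>F\<in>sets M. 0 < emeasure M F \<and> F - E \<in> null_sets M \<and> emeasure M F < \<infinity>)"
      and E: "E \<in> sets M" "emeasure M E = \<infinity>"
    then obtain F where F: "F \<in> sets M" "0 < emeasure M F" "F - E \<in> null_sets M" "emeasure M F < \<infinity>"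
      by fastforce
    \<comment> \<open>\<open>F\<close> lies below \<open>E\<close> only modulo a null set; cutting
      it down to \<open>F \<inter> E\<close> makes it a subset without loss of measure.\<close>
    have "emeasure M (F \<inter> E) = emeasure M ((F \<inter> E) \<union> (F - E))"
      using F E by (subst emeasure_Un_null_set) auto
    also have "(F \<inter> E) \<union> (F - E) = F" by auto
    finally show "\<exists>F\<in>sets M. F \<subseteq> E \<and> 0 < emeasure M F \<and> emeasure M F < \<infinity>"
      using F E by (intro bexI[of _ "F \<inter> E"]) auto
  next
    fix E assume *: "\<forall>E\<in>sets M. emeasure M E = \<infinity> \<longrightarrow>
      (\<exists>F\<in>sets M. F \<subseteq> E \<and> 0 < emeasure M F \<and> emeasure M F < \<infinity>)"
      and E: "E \<in> sets M" "0 < emeasure M E"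
    show "\<exists>F\<in>sets M. 0 < emeasure M F \<and> F - E \<in> null_sets M \<and> emeasure M F < \<infinity>"
    proof (cases "emeasure M E = \<infinity>")
      case True
      then obtain F where "F \<in> sets M" "F \<subseteq> E" "0 < emeasure M F" "emeasure M F < \<infinity>"
        using * E by blast
      moreover have "F - E = {}" using \<open>F \<subseteq> E\<close> by auto
      ultimately show ?thesis by (metis null_sets.empty_sets)
    next
      case False
      then show ?thesis using E by (intro bexI[of _ E]) (auto simp: less_top)
    qed
  qed
  finally show ?thesis by (simp add: malg_localizable_def presents_dedekind_complete[OF p])
qed


section \<open>Radon spaces are decomposable\<close>

lemma infsum_ennreal_SUP:
  fixes f :: "'a \<Rightarrow> ennreal"
  shows "infsum f A = (SUP F\<in>{F. finite F \<and> F \<subseteq> A}. sum f F)"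
  by (rule nonneg_infsum_complete) simp

lemma sum_le_infsum_ennreal:
  fixes f :: "'a \<Rightarrow> ennreal"
  assumes "finite F" "F \<subseteq> A"
  shows "sum f F \<le> infsum f A"
  unfolding infsum_ennreal_SUP using assms by (intro SUP_upper) auto

lemma emeasure_countable_UN_le:
  assumes I: "countable I" "\<And>i. i \<in> I \<Longrightarrow> X i \<in> sets M"
  shows "emeasure M (\<Union>i\<in>I. X i) \<le> (\<Sum>\<^sub>\<infinity>i\<in>I. emeasure M (X i))"
proof (cases "I = {}")
  case False
  \<comment> \<open>The enumeration may repeat indices, so partial sums run over the images of
    \<open>{..n}\<close> under \<open>g\<close>, where each index counts once.\<close>
  define g where "g = from_nat_into I"
  have g: "range g = I" using I(1) False by (simp add: g_def)
  have gI: "g n \<in> I" for n using g by auto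
  have "(\<Union>i\<in>I. X i) = (\<Union>n. \<Union>i\<in>g ` {..n}. X i)" using g by (auto; blast)
  then have "emeasure M (\<Union>i\<in>I. X i) = (SUP n. emeasure M (\<Union>i\<in>g ` {..n}. X i))"
    using I(2)[OF gI] by (simp, subst SUP_emeasure_incseq) (auto simp: incseq_def intro!: sets.finite_UN intro: order_trans)
  also have "\<dots> \<le> (\<Sum>\<^sub>\<infinity>i\<in>I. emeasure M (X i))"
  proof (rule SUP_least)
    fix n
    have "emeasure M (\<Union>i\<in>g ` {..n}. X i) \<le> (\<Sum>i\<in>g ` {..n}. emeasure M (X i))"
      using I(2) gI by (intro emeasure_subadditive_finite) auto
    also have "\<dots> \<le> (\<Sum>\<^sub>\<infinity>i\<in>I. emeasure M (X i))"
      using gI by (intro sum_le_infsum_ennreal) auto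
    finally show "emeasure M (\<Union>i\<in>g ` {..n}. X i) \<le> (\<Sum>\<^sub>\<infinity>i\<in>I. emeasure M (X i))" .
  qed
  finally show ?thesis .
qed simp

text \<open>The finite partial sums of the measures of \<open>U \<inter> K\<close> are bounded by
  the measure of \<open>U\<close>, so the family is summable, and a summable family of reals has
  only countably many nonzero terms.\<close>

lemma countable_disjoint_positive:
  assumes D: "disjoint D" "D \<subseteq> sets M" and U: "U \<in> sets M" "emeasure M U < \<infinity>"
  shows "countable {K\<in>D. 0 < emeasure M (U \<inter> K)}"
proof -
  have fin: "emeasure M (U \<inter> K) \<noteq> \<infinity>" if "K \<in> D" for K
  proof -
    have "emeasure M (U \<inter> K) \<le> emeasure M U" using D that U by (intro emeasure_mono) auto
    then show ?thesis using U by auto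
  qed
  have "(\<lambda>K. measure M (U \<inter> K)) summable_on D"
  proof (rule nonneg_bdd_above_summable_on)
    show "bdd_above (sum (\<lambda>K. measure M (U \<inter> K)) ` {F. F \<subseteq> D \<and> finite F})"
    proof (rule bdd_aboveI2)
      fix F assume F: "F \<in> {F. F \<subseteq> D \<and> finite F}"
      have "(\<Sum>K\<in>F. measure M (U \<inter> K)) = measure M (\<Union>K\<in>F. U \<inter> K)"
      proof (intro measure_finite_Union[symmetric])
        have "K \<inter> L = {}" if "K \<in> F" "L \<in> F" "K \<noteq> L" for K L
          using disjointD[OF D(1)] that F by blast
        then show "disjoint_family_on (\<lambda>K. U \<inter> K) F" unfolding disjoint_family_on_def by blast
      qed (use F D U fin in auto)
      also have "\<dots> \<le> measure M U"
        using F D U by (intro measure_mono_fmeasurable fmeasurableI) (auto intro!: sets.finite_UN)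
      finally show "(\<Sum>K\<in>F. measure M (U \<inter> K)) \<le> measure M U" .
    qed
  qed simp
  then have "countable {K\<in>D. measure M (U \<inter> K) \<noteq> 0}" by (rule summable_countable_real)
  moreover have "{K\<in>D. measure M (U \<inter> K) \<noteq> 0} = {K\<in>D. 0 < emeasure M (U \<inter> K)}"
    using fin by (auto simp: measure_def enn2real_eq_0_iff zero_less_iff_neq_zero)
  ultimately show ?thesis by simp
qed

locale radon =
  fixes T :: "'b topology" and M :: "'b measure"
  assumes radon: "radon_space T M"
begin

lemma complete: "complete_measure M"
  and locally_determined:
    "E \<subseteq> space M \<Longrightarrow> (\<And>F. F \<in> sets M \<Longrightarrow> emeasure M F < \<infinity> \<Longrightarrow> E \<inter> F \<in> sets M) \<Longrightarrow> E \<in> sets M"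
  and topspace: "topspace T = space M"
  and Hausdorff: "Hausdorff_space T"
  and open_sets: "openin T U \<Longrightarrow> U \<in> sets M"
  and inner_regular: "E \<in> sets M \<Longrightarrow> emeasure M E = (SUP C\<in>{C. C \<subseteq> E \<and> compactin T C}. emeasure M C)"
  and locally_finite: "x \<in> space M \<Longrightarrow> \<exists>U. openin T U \<and> x \<in> U \<and> emeasure M U < \<infinity>"
  using radon unfolding radon_space_def by blast+

section \<open>Compact sets in a Radon space and their supports\<close>

lemma compact_sets: "compactin T C \<Longrightarrow> C \<in> sets M"
proof -
  assume "compactin T C"
  then have "closedin T C" by (rule compactin_imp_closedin[OF Hausdorff])
  then have "C = space M - (topspace T - C)" "openin T (topspace T - C)"
    using topspace by (auto simp: closedin_def)
  then show "C \<in> sets M" using open_sets by (metis sets.compl_sets)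
qed

lemma compact_open_cover:
  assumes C: "compactin T C" and cov: "\<And>x. x \<in> C \<Longrightarrow> \<exists>U. openin T U \<and> x \<in> U \<and> Q U"
  shows "\<exists>\<F>. finite \<F> \<and> C \<subseteq> \<Union>\<F> \<and> (\<forall>U\<in>\<F>. openin T U \<and> Q U)"
proof -
  have "\<forall>U\<in>{U. openin T U \<and> Q U}. openin T U" "C \<subseteq> \<Union>{U. openin T U \<and> Q U}"
    using cov by blast+
  then obtain \<F> where "finite \<F>" "\<F> \<subseteq> {U. openin T U \<and> Q U}" "C \<subseteq> \<Union>\<F>"
    using C unfolding compactin_def by meson
  then show ?thesis by blast
qed

lemma compact_finite: "compactin T C \<Longrightarrow> emeasure M C < \<infinity>"
proof -
  assume C: "compactin T C"
  then have "\<exists>U. openin T U \<and> x \<in> U \<and> emeasure M U < \<infinity>" if "x \<in> C" for x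
    using that locally_finite compactin_subset_topspace[OF C] topspace by auto
  from compact_open_cover[OF C this] obtain \<F> where
    F: "finite \<F>" "C \<subseteq> \<Union>\<F>" "\<And>U. U \<in> \<F> \<Longrightarrow> openin T U" "\<And>U. U \<in> \<F> \<Longrightarrow> emeasure M U < \<infinity>" by blast
  have "emeasure M C \<le> emeasure M (\<Union>U\<in>\<F>. U)"
    using F open_sets by (intro emeasure_mono) (auto intro!: sets.finite_UN)
  also have "\<dots> \<le> (\<Sum>U\<in>\<F>. emeasure M U)"
    using F open_sets by (intro emeasure_subadditive_finite) auto
  also have "\<dots> < \<infinity>" using F by simp
  finally show ?thesis .
qed

lemma positive_compact_subset:
  assumes "E \<in> sets M" "0 < emeasure M E"
  shows "\<exists>C. compactin T C \<and> C \<subseteq> E \<and> 0 < emeasure M C"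
  using assms inner_regular[OF assms(1)] by (auto simp: less_SUP_iff)

text \<open>The union may be uncountable. If it had a nonnull trace on \<open>C\<close>, that trace
  would contain a compact set of positive measure, which finitely many of the null traces would
  cover.\<close>

lemma null_open_Union:
  assumes C: "compactin T C"
  shows "emeasure M (\<Union>{U. openin T U \<and> emeasure M (U \<inter> C) = 0} \<inter> C) = 0" (is "emeasure M (?N \<inter> C) = 0")
proof (rule ccontr)
  have N: "openin T ?N" by (rule openin_Union) auto
  assume "emeasure M (?N \<inter> C) \<noteq> 0"
  then obtain K where K: "compactin T K" "K \<subseteq> ?N \<inter> C" "0 < emeasure M K"
    using positive_compact_subset[of "?N \<inter> C"] open_sets[OF N] compact_sets[OF C]
    by (auto simp: zero_less_iff_neq_zero)
  have "\<exists>U. openin T U \<and> x \<in> U \<and> emeasure M (U \<inter> C) = 0" if "x \<in> K" for x using K(2) that by blast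
  from compact_open_cover[OF K(1) this] obtain \<F> where
    F: "finite \<F>" "K \<subseteq> \<Union>\<F>" "\<And>U. U \<in> \<F> \<Longrightarrow> openin T U" "\<And>U. U \<in> \<F> \<Longrightarrow> emeasure M (U \<inter> C) = 0" by blast
  have "(\<Union>U\<in>\<F>. U \<inter> C) \<in> null_sets M"
    using F open_sets compact_sets[OF C] by (intro null_sets_UN') (auto intro: countable_finite)
  moreover have "K \<subseteq> (\<Union>U\<in>\<F>. U \<inter> C)" using F(2) K(2) by auto
  ultimately have "K \<in> null_sets M" using compact_sets[OF K(1)] null_sets_subset by blast
  then show False using K(3) by auto
qed

text \<open>These are the nonnull compact sets that equal the support of the measure restricted to
  them. For them, meeting an open set means meeting it in positive measure, which turns a
  topological condition into one that can be counted.\<close>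

definition self_supporting :: "'b set \<Rightarrow> bool" where
  "self_supporting K \<longleftrightarrow> compactin T K \<and> 0 < emeasure M K \<and>
    (\<forall>U. openin T U \<longrightarrow> U \<inter> K \<noteq> {} \<longrightarrow> 0 < emeasure M (U \<inter> K))"

text \<open>Removing from \<open>C\<close> the largest open set with null trace on \<open>C\<close>
  costs no measure. An open set that still meets the rest is not contained in the removed one, so
  its trace is nonnull.\<close>

lemma self_supporting_subset:
  assumes C: "compactin T C" "0 < emeasure M C"
  shows "\<exists>K\<subseteq>C. self_supporting K"
proof -
  define N where "N = \<Union>{U. openin T U \<and> emeasure M (U \<inter> C) = 0}"
  have N: "openin T N" unfolding N_def by (rule openin_Union) auto
  have null: "N \<inter> C \<in> null_sets M"
    using null_open_Union[OF C(1)] open_sets[OF N] compact_sets[OF C(1)] by (auto simp: N_def)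
  have eq: "emeasure M E = emeasure M (E - N \<inter> C)" if "E \<in> sets M" for E
    using null that by (simp add: emeasure_Diff_null_set)
  have "compactin T (C - N)"
    using compactin_imp_closedin[OF Hausdorff C(1)] N
    by (intro closed_compactin[OF C(1)] closedin_diff) auto
  moreover have "C - N \<inter> C = C - N" by auto
  then have "0 < emeasure M (C - N)" using eq[OF compact_sets[OF C(1)]] C(2) by simp
  moreover have "0 < emeasure M (U \<inter> (C - N))" if U: "openin T U" "U \<inter> (C - N) \<noteq> {}" for U
  proof -
    have "emeasure M (U \<inter> C) \<noteq> 0" using U unfolding N_def by blast
    moreover have "U \<inter> C - N \<inter> C = U \<inter> (C - N)" by auto
    ultimately show ?thesis
      using eq[of "U \<inter> C"] open_sets[OF U(1)] compact_sets[OF C(1)]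
      by (simp add: zero_less_iff_neq_zero)
  qed
  ultimately have "self_supporting (C - N)" by (simp add: self_supporting_def)
  then show ?thesis by blast
qed

lemma maximal_self_supporting_family:
  "\<exists>\<K>. (\<forall>K\<in>\<K>. self_supporting K) \<and> disjoint \<K> \<and>
    (\<forall>K. self_supporting K \<longrightarrow> (\<forall>L\<in>\<K>. K \<inter> L = {}) \<longrightarrow> K \<in> \<K>)"
proof -
  define A where "A = {\<K>. (\<forall>K\<in>\<K>. self_supporting K) \<and> disjoint \<K>}"
  have "\<exists>\<K>\<in>A. \<forall>X\<in>A. \<K> \<subseteq> X \<longrightarrow> X = \<K>"
  proof (rule Zorn_Lemma, rule ballI)
    fix C assume "C \<in> chains A"
    then have C: "C \<subseteq> A" "chain\<^sub>\<subseteq> C" by (auto simp: chains_def)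
    then have "pairwise disjnt (\<Union>C)"
      by (intro pairwise_chain_Union) (auto simp: A_def)
    then show "\<Union>C \<in> A" using C(1) by (auto simp: A_def)
  qed
  then obtain \<K> where K: "\<K> \<in> A" "\<And>X. X \<in> A \<Longrightarrow> \<K> \<subseteq> X \<Longrightarrow> X = \<K>" by blast
  have "K \<in> \<K>" if "self_supporting K" "\<forall>L\<in>\<K>. K \<inter> L = {}" for K
  proof -
    have "insert K \<K> \<in> A" using K(1) that by (auto simp: A_def pairwise_insert disjnt_def)
    then have "insert K \<K> = \<K>" by (rule K(2)) auto
    then show ?thesis by auto
  qed
  then show ?thesis using K(1) unfolding A_def by blast
qed

text \<open>Cover \<open>C\<close> by finitely many open sets of finite measure. A member of the
  family that meets \<open>C\<close> meets one of them, hence in positive measure, and each of them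
  allows this for only countably many disjoint sets.\<close>

lemma compact_countable_meets:
  assumes K: "\<forall>K\<in>\<K>. self_supporting K" "disjoint \<K>" and C: "compactin T C"
  shows "countable {K\<in>\<K>. C \<inter> K \<noteq> {}}"
proof -
  have sets: "\<K> \<subseteq> sets M" using K(1) compact_sets by (auto simp: self_supporting_def)
  have "\<exists>U. openin T U \<and> x \<in> U \<and> emeasure M U < \<infinity>" if "x \<in> C" for x
    using that locally_finite compactin_subset_topspace[OF C] topspace by auto
  from compact_open_cover[OF C this] obtain \<F> where
    F: "finite \<F>" "C \<subseteq> \<Union>\<F>" "\<And>U. U \<in> \<F> \<Longrightarrow> openin T U" "\<And>U. U \<in> \<F> \<Longrightarrow> emeasure M U < \<infinity>" by blast
  have "countable (\<Union>U\<in>\<F>. {K\<in>\<K>. 0 < emeasure M (U \<inter> K)})"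
    using F countable_disjoint_positive[OF K(2) sets] open_sets
    by (intro countable_UN) (auto intro: countable_finite)
  moreover have "{K\<in>\<K>. C \<inter> K \<noteq> {}} \<subseteq> (\<Union>U\<in>\<F>. {K\<in>\<K>. 0 < emeasure M (U \<inter> K)})"
  proof
    fix K assume "K \<in> {K\<in>\<K>. C \<inter> K \<noteq> {}}"
    then obtain x where x: "K \<in> \<K>" "x \<in> C" "x \<in> K" by auto
    then obtain U where U: "U \<in> \<F>" "x \<in> U" using F(2) by auto
    then have "0 < emeasure M (U \<inter> K)"
      using K(1) x F(3) unfolding self_supporting_def by blast
    then show "K \<in> (\<Union>U\<in>\<F>. {K\<in>\<K>. 0 < emeasure M (U \<inter> K)})" using U x by auto
  qed
  ultimately show ?thesis by (rule countable_subset[rotated])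
qed

lemma sigma_compact_approx:
  assumes E: "E \<in> sets M" "emeasure M E < \<infinity>"
  shows "\<exists>C :: nat \<Rightarrow> 'b set. (\<forall>n. compactin T (C n)) \<and> (\<forall>n. C n \<subseteq> E) \<and> E - (\<Union>n. C n) \<in> null_sets M"
proof -
  define Q where "Q = emeasure M ` {C. C \<subseteq> E \<and> compactin T C}"
  have "Q \<noteq> {}" unfolding Q_def by (auto intro: exI[of _ "{}"])
  from ennreal_Sup_countable_SUP[OF this]
  obtain f :: "nat \<Rightarrow> ennreal" where f: "range f \<subseteq> Q" "Sup Q = (SUP i. f i)" by blast
  have "\<forall>n. \<exists>C. compactin T C \<and> C \<subseteq> E \<and> f n = emeasure M C"
    using f(1) unfolding Q_def by (auto simp: image_subset_iff image_iff)
  then obtain C where C: "\<And>n. compactin T (C n)" "\<And>n. C n \<subseteq> E" "\<And>n. f n = emeasure M (C n)"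
    by metis
  let ?C = "\<Union>n. C n"
  have CM: "?C \<in> sets M" using compact_sets[OF C(1)] by auto
  have "emeasure M E = Sup Q" unfolding Q_def by (rule inner_regular[OF E(1)])
  also have "\<dots> \<le> emeasure M ?C"
    unfolding f(2) C(3) using CM by (intro SUP_least emeasure_mono) auto
  finally have "emeasure M E \<le> emeasure M ?C" .
  moreover have CE: "?C \<subseteq> E" using C(2) by auto
  ultimately have eq: "emeasure M E = emeasure M ?C"
    using emeasure_mono[OF CE E(1)] by (intro antisym)
  have "emeasure M (E - ?C) = emeasure M E - emeasure M ?C"
    using CM CE E by (intro emeasure_Diff) (auto simp: eq)
  also have "\<dots> = 0" using E(2) eq by simp
  finally have "E - ?C \<in> null_sets M" using CM E(1) by auto
  then show ?thesis using C by blast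
qed

section \<open>The decomposition of a Radon space\<close>

text \<open>By local determination it is enough to look inside a set \<open>F\<close> of finite
  measure. Up to a null set, \<open>F\<close> is a countable union of compact sets, on each of which
  only countably many \<open>B K\<close> appear; completeness handles the null rest.\<close>

lemma glue_sets:
  assumes K: "\<forall>K\<in>\<K>. self_supporting K" "disjoint \<K>"
    and B: "\<And>K. K \<in> \<K> \<Longrightarrow> B K \<in> sets M" "\<And>K. K \<in> \<K> \<Longrightarrow> B K \<subseteq> K"
  shows "(\<Union>K\<in>\<K>. B K) \<in> sets M"
proof (rule locally_determined)
  let ?G = "\<Union>K\<in>\<K>. B K"
  show "?G \<subseteq> space M" using B(1)[THEN sets.sets_into_space] by auto
  fix F assume F: "F \<in> sets M" "emeasure M F < \<infinity>"
  obtain C :: "nat \<Rightarrow> 'b set" where C: "\<And>n. compactin T (C n)" "\<And>n. C n \<subseteq> F" "F - (\<Union>n. C n) \<in> null_sets M"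
    using sigma_compact_approx[OF F] by blast
  have "?G \<inter> C n \<in> sets M" for n
  proof -
    have "?G \<inter> C n = (\<Union>K\<in>{K\<in>\<K>. C n \<inter> K \<noteq> {}}. B K \<inter> C n)" using B(2) by auto
    also have "\<dots> \<in> sets M"
      using compact_countable_meets[OF K C(1)] B(1) compact_sets[OF C(1)]
      by (intro sets.countable_UN') auto
    finally show ?thesis .
  qed
  moreover have "?G \<inter> (F - (\<Union>n. C n)) \<in> sets M"
    using complete_measure.complete[OF complete _ C(3)] by auto
  moreover have "?G \<inter> F = (\<Union>n. ?G \<inter> C n) \<union> (?G \<inter> (F - (\<Union>n. C n)))" using C(2) by auto
  ultimately show "?G \<inter> F \<in> sets M" by (metis sets.countable_UN'' sets.Un countableI_type)
qed

lemma decomposable: "decomposable_space M"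
proof -
  obtain \<K> where K: "\<forall>K\<in>\<K>. self_supporting K" "disjoint \<K>"
    and max: "\<And>K. self_supporting K \<Longrightarrow> (\<forall>L\<in>\<K>. K \<inter> L = {}) \<Longrightarrow> K \<in> \<K>"
    using maximal_self_supporting_family by blast
  have Kc: "compactin T K" "K \<in> sets M" "0 < emeasure M K" "emeasure M K < \<infinity>" if "K \<in> \<K>" for K
    using K(1) that compact_sets compact_finite by (auto simp: self_supporting_def)
  have UK: "\<Union>\<K> \<in> sets M" using glue_sets[OF K, of "\<lambda>K. K"] Kc by simp
  define N where "N = space M - \<Union>\<K>"
  have N: "N \<in> sets M" using UK by (auto simp: N_def)
  \<comment> \<open>If \<open>N\<close> were not null, it would contain a self-supporting set
    disjoint from the whole family, which maximality forbids.\<close>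
  have N0: "N \<in> null_sets M"
  proof (rule ccontr)
    assume "N \<notin> null_sets M"
    then have "0 < emeasure M N" using N by (auto simp: zero_less_iff_neq_zero)
    then obtain C where C: "compactin T C" "C \<subseteq> N" "0 < emeasure M C"
      using positive_compact_subset N by blast
    obtain K where K': "K \<subseteq> C" "self_supporting K" using self_supporting_subset[OF C(1,3)] by blast
    have "\<forall>L\<in>\<K>. K \<inter> L = {}" using K' C(2) by (auto simp: N_def)
    then have "K \<in> \<K>" using max K' by blast
    \<comment> \<open>\<open>K\<close> is now a member, hence disjoint from itself.\<close>
    then have "K = {}" using \<open>\<forall>L\<in>\<K>. K \<inter> L = {}\<close> by blast
    then show False using K'(2) by (simp add: self_supporting_def)
  qed
  \<comment> \<open>Members of a partition are nonempty, so \<open>N\<close> is added only if it is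
    nonempty.\<close>
  define P where "P = \<K> \<union> ({N} - {{}})"
  have PM: "X \<in> sets M" "emeasure M X < \<infinity>" if "X \<in> P" for X
    using that Kc N N0 by (auto simp: P_def)
  have NK: "N \<inter> K = {}" if "K \<in> \<K>" for K using that by (auto simp: N_def)
  have cover: "E = (\<Union>K\<in>\<K>. E \<inter> K) \<union> (E \<inter> N)" if "E \<subseteq> space M" for E
    using that by (auto simp: N_def)
  have disjP: "disjoint P" unfolding P_def using K(2) NK by (auto simp: disjoint_def)
  have part: "partition_on (space M) P"
  proof (rule partition_onI)
    have "\<Union>P = \<Union>\<K> \<union> N" unfolding P_def by blast
    then show "\<Union>P = space M" using sets.sets_into_space[OF UK] unfolding N_def by blast
    have "{} \<notin> \<K>" using Kc(3) by fastforce
    then show "{} \<notin> P" by (simp add: P_def)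
  qed (use disjP in \<open>simp add: disjoint_def disjnt_def\<close>)
  have sets: "E \<in> sets M" if "E \<subseteq> space M" "\<forall>X\<in>P. E \<inter> X \<in> sets M" for E
  proof -
    have "(\<Union>K\<in>\<K>. E \<inter> K) \<in> sets M" using that(2) by (intro glue_sets[OF K]) (auto simp: P_def)
    moreover have "E \<inter> N \<in> sets M" using complete_measure.complete[OF complete _ N0] by auto
    ultimately show ?thesis by (subst cover[OF that(1)]) (rule sets.Un)
  qed
  have em: "emeasure M E = (\<Sum>\<^sub>\<infinity>X\<in>P. emeasure M (E \<inter> X))" if E: "E \<in> sets M" for E
  proof (rule antisym)
    show "(\<Sum>\<^sub>\<infinity>X\<in>P. emeasure M (E \<inter> X)) \<le> emeasure M E"
      unfolding infsum_ennreal_SUP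
    proof (rule SUP_least)
      fix F assume F: "F \<in> {F. finite F \<and> F \<subseteq> P}"
      have "(\<Sum>X\<in>F. emeasure M (E \<inter> X)) = emeasure M (\<Union>X\<in>F. E \<inter> X)"
      proof (intro sum_emeasure)
        have "X \<inter> Y = {}" if "X \<in> F" "Y \<in> F" "X \<noteq> Y" for X Y
          using disjointD[OF disjP] that F by blast
        then show "disjoint_family_on (\<lambda>X. E \<inter> X) F" unfolding disjoint_family_on_def by blast
      qed (use F PM E in auto)
      also have "\<dots> \<le> emeasure M E" using E by (intro emeasure_mono) auto
      finally show "(\<Sum>X\<in>F. emeasure M (E \<inter> X)) \<le> emeasure M E" .
    qed
    \<comment> \<open>Countable subadditivity does not reach all of \<open>P\<close>. By inner
      regularity it suffices to bound the compact subsets of \<open>E\<close>, which meet only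
      countably many pieces.\<close>
    show "emeasure M E \<le> (\<Sum>\<^sub>\<infinity>X\<in>P. emeasure M (E \<inter> X))"
      unfolding inner_regular[OF E]
    proof (rule SUP_least)
      fix C assume "C \<in> {C. C \<subseteq> E \<and> compactin T C}"
      then have C: "C \<subseteq> E" "compactin T C" by auto
      define I where "I = {K\<in>\<K>. C \<inter> K \<noteq> {}}"
      have I: "countable I" unfolding I_def by (rule compact_countable_meets[OF K C(2)])
      have CM: "C \<in> sets M" by (rule compact_sets[OF C(2)])
      have "C = (\<Union>K\<in>I. C \<inter> K) \<union> (C \<inter> N)"
        using sets.sets_into_space[OF CM] by (auto simp: I_def N_def)
      then have "emeasure M C = emeasure M ((\<Union>K\<in>I. C \<inter> K) \<union> (C \<inter> N))" by (rule arg_cong)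
      also have "\<dots> = emeasure M (\<Union>K\<in>I. C \<inter> K)"
        using I Kc(2) CM null_set_Int1[OF N0 CM]
        by (intro emeasure_Un_null_set sets.countable_UN') (auto simp: I_def)
      also have "\<dots> \<le> (\<Sum>\<^sub>\<infinity>K\<in>I. emeasure M (C \<inter> K))"
        using I Kc CM by (intro emeasure_countable_UN_le) (auto simp: I_def)
      also have "\<dots> \<le> (\<Sum>\<^sub>\<infinity>X\<in>P. emeasure M (E \<inter> X))"
        unfolding infsum_ennreal_SUP[of _ I]
      proof (rule SUP_least)
        fix F assume F: "F \<in> {F. finite F \<and> F \<subseteq> I}"
        have "(\<Sum>K\<in>F. emeasure M (C \<inter> K)) \<le> (\<Sum>K\<in>F. emeasure M (E \<inter> K))"
          using F C E Kc(2) by (intro sum_mono emeasure_mono) (auto simp: I_def)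
        also have "\<dots> \<le> (\<Sum>\<^sub>\<infinity>X\<in>P. emeasure M (E \<inter> X))"
          using F by (intro sum_le_infsum_ennreal) (auto simp: I_def P_def)
        finally show "(\<Sum>K\<in>F. emeasure M (C \<inter> K)) \<le> (\<Sum>\<^sub>\<infinity>X\<in>P. emeasure M (E \<inter> X))" .
      qed
      finally show "emeasure M C \<le> (\<Sum>\<^sub>\<infinity>X\<in>P. emeasure M (E \<inter> X))" .
    qed
  qed
  have "sets M = {E. E \<subseteq> space M \<and> (\<forall>X\<in>P. E \<inter> X \<in> sets M)}"
    (is "_ = ?R")
  proof (intro subset_antisym subsetI)
    fix E assume E: "E \<in> sets M"
    then show "E \<in> ?R" using PM(1) sets.sets_into_space by (intro CollectI conjI ballI sets.Int)
  next
    fix E assume "E \<in> ?R"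
    then show "E \<in> sets M" using sets by (elim CollectE conjE)
  qed
  with part PM em show ?thesis unfolding decomposable_space_def
    by (intro exI[of _ P] conjI ballI)
qed

end


section \<open>The Radon measure on a space of clopen sets\<close>

text \<open>The part of the Stone representation that the measure construction uses.
  \<open>V\<close> stands for the algebra: \<open>hull_exists\<close> is Dedekind completeness, and
  in \<open>m_additive\<close> the set \<open>S\<close> is the supremum of the sequence, which may
  exceed its union. \<open>finite_subcover\<close> will give compactness of the clopen sets of
  finite measure.\<close>

locale clopen_measure = algebra X V for X :: "'x set" and V :: "'x set set" +
  fixes m :: "'x set \<Rightarrow> ennreal"
  assumes hull_exists: "D \<subseteq> V \<Longrightarrow> \<exists>S\<in>V. \<Union>D \<subseteq> S \<and> (\<forall>W\<in>V. \<Union>D \<subseteq> W \<longrightarrow> S \<subseteq> W)"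
    and m_zero_iff: "B \<in> V \<Longrightarrow> m B = 0 \<longleftrightarrow> B = {}"
    and m_additive: "\<lbrakk>range A \<subseteq> V; disjoint_family A; S \<in> V; (\<Union>n. A n) \<subseteq> S;
        \<And>W. W \<in> V \<Longrightarrow> (\<Union>n. A n) \<subseteq> W \<Longrightarrow> S \<subseteq> W\<rbrakk> \<Longrightarrow> m S = (\<Sum>n::nat. m (A n))"
    and semifinite: "B \<in> V \<Longrightarrow> B \<noteq> {} \<Longrightarrow> \<exists>C\<in>V. C \<noteq> {} \<and> C \<subseteq> B \<and> m C < \<infinity>"
    and finite_nbhd: "x \<in> X \<Longrightarrow> \<exists>B\<in>V. x \<in> B \<and> m B < \<infinity>"
    and separated: "x \<in> X \<Longrightarrow> y \<in> X \<Longrightarrow> x \<noteq> y \<Longrightarrow> \<exists>B\<in>V. x \<in> B \<and> y \<notin> B"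
    and finite_subcover: "\<lbrakk>B \<in> V; m B < \<infinity>; \<C> \<subseteq> V; B \<subseteq> \<Union>\<C>\<rbrakk> \<Longrightarrow> \<exists>\<F>\<subseteq>\<C>. finite \<F> \<and> B \<subseteq> \<Union>\<F>"
begin

section \<open>Hulls and continuity of the measure on clopen sets\<close>

lemma V_subset: "B \<in> V \<Longrightarrow> B \<subseteq> X"
  using space_closed by auto

text \<open>For a union of members of \<open>V\<close> this is its closure in the topology
  \<open>T\<close> below; it stands for the supremum in the algebra.\<close>

definition clopen_hull :: "'x set \<Rightarrow> 'x set" where
  "clopen_hull G = (SOME S. S \<in> V \<and> G \<subseteq> S \<and> (\<forall>W\<in>V. G \<subseteq> W \<longrightarrow> S \<subseteq> W))"

lemma hull_lub:
  assumes "D \<subseteq> V"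
  shows hull_in: "clopen_hull (\<Union>D) \<in> V" and hull_upper: "\<Union>D \<subseteq> clopen_hull (\<Union>D)"
    and hull_least: "W \<in> V \<Longrightarrow> \<Union>D \<subseteq> W \<Longrightarrow> clopen_hull (\<Union>D) \<subseteq> W"
proof -
  have "clopen_hull (\<Union>D) \<in> V \<and> \<Union>D \<subseteq> clopen_hull (\<Union>D) \<and> (\<forall>W\<in>V. \<Union>D \<subseteq> W \<longrightarrow> clopen_hull (\<Union>D) \<subseteq> W)"
    unfolding clopen_hull_def by (rule someI_ex) (use hull_exists[OF assms] in \<open>simp add: Bex_def\<close>)
  then show "clopen_hull (\<Union>D) \<in> V" "\<Union>D \<subseteq> clopen_hull (\<Union>D)" "W \<in> V \<Longrightarrow> \<Union>D \<subseteq> W \<Longrightarrow> clopen_hull (\<Union>D) \<subseteq> W"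
    by blast+
qed

text \<open>\<open>X - B\<close> is itself a member of \<open>V\<close> containing the union. In
  topological terms, an open set that misses a set misses its closure.\<close>

lemma hull_disjoint:
  assumes "D \<subseteq> V" "B \<in> V" "B \<inter> \<Union>D = {}"
  shows "B \<inter> clopen_hull (\<Union>D) = {}"
proof -
  have "\<Union>D \<subseteq> X - B" using assms V_subset by blast
  then have "clopen_hull (\<Union>D) \<subseteq> X - B" using assms by (intro hull_least) auto
  then show ?thesis by auto
qed

lemma m_empty: "m {} = 0"
  by (simp add: m_zero_iff)

lemma m_Un:
  assumes "A \<in> V" "B \<in> V" "A \<inter> B = {}"
  shows "m (A \<union> B) = m A + m B"
proof -
  have "m (A \<union> B) = (\<Sum>n. m (binaryset A B n))"
    using assms by (intro m_additive)
      (auto simp: range_binaryset_eq UN_binaryset_eq disjoint_family_on_def binaryset_def)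
  then show ?thesis using suminf_binaryset_eq[of m A B] m_empty by simp
qed

lemma m_Diff:
  assumes "A \<in> V" "B \<in> V" "B \<subseteq> A"
  shows "m A = m B + m (A - B)"
proof -
  have "A = B \<union> (A - B)" using assms by auto
  then show ?thesis using m_Un[of B "A - B"] assms by auto
qed

lemma m_mono: "A \<in> V \<Longrightarrow> B \<in> V \<Longrightarrow> B \<subseteq> A \<Longrightarrow> m B \<le> m A"
  using m_Diff[of A B] by simp

lemma m_hull_disjointed:
  fixes A :: "nat \<Rightarrow> 'x set"
  assumes "range A \<subseteq> V"
  shows "m (clopen_hull (\<Union>n. A n)) = (\<Sum>n. m (disjointed A n))"
  using hull_lub[OF assms] range_disjointed_sets[OF assms]
  by (intro m_additive) (auto simp: disjoint_family_disjointed UN_disjointed_eq)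

lemma m_hull_le_suminf:
  fixes A :: "nat \<Rightarrow> 'x set"
  assumes "range A \<subseteq> V"
  shows "m (clopen_hull (\<Union>n. A n)) \<le> (\<Sum>n. m (A n))"
  unfolding m_hull_disjointed[OF assms]
  using assms range_disjointed_sets[OF assms] disjointed_subset[of A]
  by (intro suminf_le m_mono) auto

lemma m_hull_incseq:
  fixes A :: "nat \<Rightarrow> 'x set"
  assumes A: "range A \<subseteq> V" "incseq A"
  shows "m (clopen_hull (\<Union>n. A n)) = (SUP n. m (A n))"
proof -
  have AV: "A n \<in> V" for n using A(1) by auto
  have dV: "disjointed A n \<in> V" for n using range_disjointed_sets[OF A(1)] by auto
  have "(\<Sum>i<Suc n. m (disjointed A i)) = m (A n)" for n
  proof (induction n)
    case (Suc n)
    have "disjointed A (Suc n) = A (Suc n) - A n"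
      using A(2) by (simp add: disjointed_mono)
    then have "m (A (Suc n)) = m (A n) + m (disjointed A (Suc n))"
      using AV incseqD[OF A(2), of n "Suc n"] m_Diff by simp
    then show ?case using Suc by simp
  qed (simp add: disjointed_def)
  then have "(SUP n. m (A n)) = (SUP n. \<Sum>i<Suc n. m (disjointed A i))" by simp
  \<comment> \<open>Sums of \<open>Suc n\<close> terms match \<open>A n\<close>, whereas the
    infinite sum is the supremum of sums of \<open>n\<close> terms; the shift does not change the
    supremum because the sums increase.\<close>
  also have "\<dots> = (SUP n. \<Sum>i<n. m (disjointed A i))"
  proof (rule antisym)
    have "(\<Sum>i<n. m (disjointed A i)) \<le> (\<Sum>i<Suc n. m (disjointed A i))" for n by simp
    then show "(SUP n. \<Sum>i<n. m (disjointed A i)) \<le> (SUP n. \<Sum>i<Suc n. m (disjointed A i))"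
      by (intro SUP_mono) blast
    show "(SUP n. \<Sum>i<Suc n. m (disjointed A i)) \<le> (SUP n. \<Sum>i<n. m (disjointed A i))"
      by (intro SUP_least SUP_upper UNIV_I)
  qed
  finally show ?thesis by (simp add: m_hull_disjointed[OF A(1)] suminf_eq_SUP)
qed

text \<open>A sequence in \<open>D\<close> along which \<open>m\<close> tends to its supremum already has the same supremum as \<open>D\<close>:
  the excess of any further member of \<open>D\<close> has measure zero.\<close>

lemma m_hull_directed:
  assumes D: "D \<subseteq> V" "D \<noteq> {}" "\<And>A B. A \<in> D \<Longrightarrow> B \<in> D \<Longrightarrow> A \<union> B \<in> D"
  shows "m (clopen_hull (\<Union>D)) = (SUP B\<in>D. m B)"
proof (rule antisym)
  show "(SUP B\<in>D. m B) \<le> m (clopen_hull (\<Union>D))"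
    using hull_lub[OF D(1)] D(1) by (intro SUP_least m_mono) auto
  show "m (clopen_hull (\<Union>D)) \<le> (SUP B\<in>D. m B)"
  proof (cases "(SUP B\<in>D. m B) = \<infinity>")
    case False
    have "m ` D \<noteq> {}" using D(2) by simp
    from ennreal_Sup_countable_SUP[OF this]
    obtain f :: "nat \<Rightarrow> ennreal" where f: "range f \<subseteq> m ` D" "Sup (m ` D) = (SUP i. f i)" by blast
    have "\<forall>n. \<exists>B. B \<in> D \<and> f n = m B" using f(1) by auto
    then obtain B where B: "\<And>n. B n \<in> D" "\<And>n. f n = m (B n)" by metis
    define A where "A n = (\<Union>i\<le>n. B i)" for n
    have AD: "A n \<in> D" for n
      by (induction n) (auto simp: A_def atMost_Suc B(1) intro: D(3))
    have AV: "range A \<subseteq> V" using AD D(1) by auto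
    have incA: "incseq A" unfolding A_def incseq_def by force
    define W where "W = clopen_hull (\<Union>n. A n)"
    have W: "W \<in> V" "(\<Union>n. A n) \<subseteq> W" using hull_lub[OF AV] by (auto simp: W_def)
    have mW: "m W = (SUP n. m (A n))" unfolding W_def by (rule m_hull_incseq[OF AV incA])
    have "m (B n) \<le> m (A n)" for n
      using B(1) D(1) AV by (intro m_mono) (auto simp: A_def)
    then have W_ge: "(SUP B\<in>D. m B) \<le> m W"
      unfolding f(2) B(2) mW by (intro SUP_mono) blast
    have "C \<subseteq> W" if C: "C \<in> D" for C
    proof -
      have CV: "C \<in> V" using C D(1) by auto
      let ?A = "\<lambda>n. C \<union> A n"
      have A': "range ?A \<subseteq> V" using CV AV by auto
      have incA': "incseq ?A" using incA by (auto simp: incseq_def)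
      have "C \<union> W \<subseteq> clopen_hull (\<Union>n. ?A n)"
      proof -
        have *: "C \<union> (\<Union>n. A n) \<subseteq> clopen_hull (\<Union>n. ?A n)" using hull_upper[OF A'] by auto
        have "W \<subseteq> clopen_hull (\<Union>n. ?A n)"
          unfolding W_def using hull_in[OF A'] * by (intro hull_least[OF AV]) auto
        then show ?thesis using * by auto
      qed
      then have "m (C \<union> W) \<le> m (clopen_hull (\<Union>n. ?A n))"
        using CV W hull_in[OF A'] by (intro m_mono) auto
      also have "\<dots> = (SUP n. m (?A n))" by (rule m_hull_incseq[OF A' incA'])
      also have "\<dots> \<le> (SUP B\<in>D. m B)"
        using C AD by (intro SUP_least SUP_upper D(3)) auto
      finally have le: "m (C \<union> W) \<le> (SUP B\<in>D. m B)" .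
      have "m W \<le> m (C \<union> W)" using CV W(1) by (intro m_mono) auto
      then have "m W \<le> (SUP B\<in>D. m B)" using le by (rule order_trans)
      then have mW_fin: "m W \<noteq> \<infinity>" using False by (metis infinity_ennreal_def top.extremum_unique)
      have "C - W \<in> V" using CV W(1) by (rule Diff)
      then have "m W + m (C - W) = m (C \<union> W)"
        using m_Un[of W "C - W"] W(1) by (simp add: Un_commute)
      also have "\<dots> \<le> m W + 0" using order_trans[OF le W_ge] by simp
      finally have "m (C - W) \<le> 0"
        using mW_fin by (subst (asm) ennreal_add_left_cancel_le) auto
      then have "C - W = {}" using m_zero_iff[of "C - W"] CV W(1) by auto
      then show ?thesis by auto
    qed
    then have "clopen_hull (\<Union>D) \<subseteq> W" using W by (intro hull_least[OF D(1)]) auto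
    then have "m (clopen_hull (\<Union>D)) \<le> m W" using hull_in[OF D(1)] W by (intro m_mono)
    also have "\<dots> \<le> (SUP B\<in>D. m B)"
      unfolding mW using AD by (intro SUP_least SUP_upper)
    finally show ?thesis .
  qed (metis infinity_ennreal_def top_greatest)
qed

section \<open>Clopen interiors\<close>

text \<open>Topologically the closure of the interior of \<open>E\<close>. For measurable
  \<open>E\<close> it is the element of the algebra that \<open>E\<close> represents.\<close>

definition clopen_inner :: "'x set \<Rightarrow> 'x set" where
  "clopen_inner E = clopen_hull (\<Union>{B \<in> V. B \<subseteq> E})"

lemma inner_in: "clopen_inner E \<in> V"
  unfolding clopen_inner_def by (rule hull_in) auto

lemma inner_upper: "B \<in> V \<Longrightarrow> B \<subseteq> E \<Longrightarrow> B \<subseteq> clopen_inner E"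
  using hull_upper[of "{B \<in> V. B \<subseteq> E}"] unfolding clopen_inner_def by auto

lemma inner_least: "W \<in> V \<Longrightarrow> (\<And>B. B \<in> V \<Longrightarrow> B \<subseteq> E \<Longrightarrow> B \<subseteq> W) \<Longrightarrow> clopen_inner E \<subseteq> W"
  unfolding clopen_inner_def by (rule hull_least) auto

lemma inner_mono: "E \<subseteq> F \<Longrightarrow> clopen_inner E \<subseteq> clopen_inner F"
  by (rule inner_least[OF inner_in]) (auto dest: inner_upper)

text \<open>If \<open>B\<close> contained no nonempty clopen subset of \<open>E\<close>, it would be
  disjoint from all clopen subsets of \<open>E\<close>, hence from their hull.\<close>

lemma inner_dense:
  assumes "B \<in> V" "B \<subseteq> clopen_inner E" "B \<noteq> {}"
  shows "\<exists>C\<in>V. C \<noteq> {} \<and> C \<subseteq> B \<and> C \<subseteq> E"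
proof (rule ccontr)
  assume no: "\<not> ?thesis"
  have "B \<inter> \<Union>{C \<in> V. C \<subseteq> E} = {}"
  proof (rule ccontr)
    assume "B \<inter> \<Union>{C \<in> V. C \<subseteq> E} \<noteq> {}"
    then obtain C where "C \<in> V" "C \<subseteq> E" "B \<inter> C \<noteq> {}" by auto
    moreover have "B \<inter> C \<in> V" using assms(1) \<open>C \<in> V\<close> by (rule Int)
    moreover have "B \<inter> C \<subseteq> B" "B \<inter> C \<subseteq> E" using \<open>C \<subseteq> E\<close> by auto
    ultimately show False using no \<open>B \<inter> C \<noteq> {}\<close> by (meson)
  qed
  then have "B \<inter> clopen_inner E = {}" unfolding clopen_inner_def using assms(1) by (intro hull_disjoint) auto
  then show False using assms by auto
qed

text \<open>Converse of \<open>inner_dense\<close>. Together the two reduce inclusions in a clopen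
  interior to finding small nonempty clopen sets.\<close>

lemma subset_innerI:
  assumes Q: "Q \<in> V" and dense: "\<And>B. B \<in> V \<Longrightarrow> B \<subseteq> Q \<Longrightarrow> B \<noteq> {} \<Longrightarrow> \<exists>C\<in>V. C \<noteq> {} \<and> C \<subseteq> B \<and> C \<subseteq> E"
  shows "Q \<subseteq> clopen_inner E"
proof (rule ccontr)
  assume "\<not> Q \<subseteq> clopen_inner E"
  then have "Q - clopen_inner E \<noteq> {}" by auto
  moreover have "Q - clopen_inner E \<in> V" using Q inner_in by auto
  ultimately obtain C where "C \<in> V" "C \<noteq> {}" "C \<subseteq> Q - clopen_inner E" "C \<subseteq> E"
    using dense[of "Q - clopen_inner E"] by auto
  then show False using inner_upper[of C E] by auto
qed

lemma inner_clopen: "B \<in> V \<Longrightarrow> clopen_inner B = B"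
  using inner_upper[of B B] inner_least[of B B] by auto

lemma inner_Int: "clopen_inner (E \<inter> F) = clopen_inner E \<inter> clopen_inner F"
proof
  show "clopen_inner (E \<inter> F) \<subseteq> clopen_inner E \<inter> clopen_inner F" using inner_mono[of "E \<inter> F"] by auto
  show "clopen_inner E \<inter> clopen_inner F \<subseteq> clopen_inner (E \<inter> F)"
  proof (rule subset_innerI)
    fix B assume B: "B \<in> V" "B \<subseteq> clopen_inner E \<inter> clopen_inner F" "B \<noteq> {}"
    then obtain C where C: "C \<in> V" "C \<noteq> {}" "C \<subseteq> B" "C \<subseteq> E" using inner_dense[of B E] by auto
    have "C \<subseteq> clopen_inner F" using C(3) B(2) by auto
    then obtain C' where "C' \<in> V" "C' \<noteq> {}" "C' \<subseteq> C" "C' \<subseteq> F" using inner_dense[OF C(1) _ C(2)] by blast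
    then show "\<exists>C\<in>V. C \<noteq> {} \<and> C \<subseteq> B \<and> C \<subseteq> E \<inter> F"
      using C(3,4) by (intro bexI[of _ C']) auto
  qed (use inner_in in auto)
qed

text \<open>Semifiniteness puts a nonempty clopen set of finite measure below every nonempty clopen
  one, so those inside \<open>E\<close> already have the hull \<open>clopen_inner E\<close>. They
  are closed under unions, so \<open>m_hull_directed\<close> applies. This will become inner
  regularity.\<close>

lemma m_inner:
  "m (clopen_inner E) = (SUP B\<in>{B \<in> V. B \<subseteq> E \<and> m B < \<infinity>}. m B)"
proof -
  let ?D = "{B \<in> V. B \<subseteq> E \<and> m B < \<infinity>}"
  have D: "?D \<subseteq> V" by auto
  have "clopen_hull (\<Union>?D) = clopen_inner E"
  proof
    show "clopen_hull (\<Union>?D) \<subseteq> clopen_inner E"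
      using inner_upper by (intro hull_least[OF D inner_in]) auto
    have "clopen_inner E - clopen_hull (\<Union>?D) = {}"
    proof (rule ccontr)
      assume "clopen_inner E - clopen_hull (\<Union>?D) \<noteq> {}"
      moreover have "clopen_inner E - clopen_hull (\<Union>?D) \<in> V" using inner_in hull_in[OF D] by auto
      ultimately obtain C where C: "C \<in> V" "C \<noteq> {}" "C \<subseteq> clopen_inner E - clopen_hull (\<Union>?D)" "C \<subseteq> E"
        using inner_dense[of "clopen_inner E - clopen_hull (\<Union>?D)" E] by auto
      obtain B where B: "B \<in> V" "B \<noteq> {}" "B \<subseteq> C" "m B < \<infinity>" using semifinite[OF C(1,2)] by blast
      then have "B \<in> ?D" using C(4) by auto
      then have "B \<subseteq> clopen_hull (\<Union>?D)" using hull_upper[OF D] by (meson Union_upper order_trans)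
      then show False using B(2,3) C(3) by auto
    qed
    then show "clopen_inner E \<subseteq> clopen_hull (\<Union>?D)" by auto
  qed
  moreover have "m (clopen_hull (\<Union>?D)) = (SUP B\<in>?D. m B)"
  proof (rule m_hull_directed[OF D])
    show "?D \<noteq> {}" by (auto simp: m_empty intro!: exI[of _ "{}"])
    fix A B assume AB: "A \<in> ?D" "B \<in> ?D"
    have "m (A \<union> B) = m A + m (A \<union> B - A)" using AB by (intro m_Diff) auto
    also have "\<dots> \<le> m A + m B" using AB by (intro add_left_mono m_mono) auto
    also have "\<dots> < \<infinity>" using AB by simp
    finally show "A \<union> B \<in> ?D" using AB by auto
  qed
  ultimately show ?thesis by simp
qed

text \<open>Weak \<open>\<sigma>\<close>-distributivity: if a nonzero part \<open>R\<close> of \<open>Q\<close> of finite measure missed the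
  interior of the intersection, approximate \<open>R\<close> from within the \<open>n\<close>-th set up to \<open>m R / 2\<^bsup>n+2\<^esup>\<close>;
  the errors add up to at most half of \<open>R\<close>, and what is left lies in all the sets.\<close>

lemma inner_INT:
  fixes F :: "nat \<Rightarrow> 'x set"
  assumes Q: "Q \<in> V" and F: "\<And>n. Q \<subseteq> clopen_inner (F n)"
  shows "Q \<subseteq> clopen_inner (\<Inter>n. F n)"
proof (rule subset_innerI[OF Q])
  fix B assume B: "B \<in> V" "B \<subseteq> Q" "B \<noteq> {}"
  obtain R where R: "R \<in> V" "R \<noteq> {}" "R \<subseteq> B" "m R < \<infinity>" using semifinite[OF B(1,3)] by blast
  define r where "r = enn2real (m R)"
  have r: "m R = ennreal r" using R(4) by (simp add: r_def)
  have "m R \<noteq> 0" using R m_zero_iff by auto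
  then have r0: "r > 0" using r by (metis ennreal_neg not_le)
  define d where "d n = r / 2 * (1/2) ^ Suc n" for n
  have d0: "d n > 0" for n using r0 by (simp add: d_def)
  have dsum: "d sums (r / 2)"
    using sums_mult[OF power_half_series, of "r/2"] by (simp add: d_def[abs_def])
  have "\<exists>C\<in>V. C \<subseteq> F n \<and> C \<subseteq> R \<and> m (R - C) \<le> ennreal (d n)" for n
  proof -
    have "clopen_inner (F n \<inter> R) = clopen_inner (F n) \<inter> R" using inner_Int inner_clopen[OF R(1)] by simp
    also have "\<dots> = R" using F[of n] B R by auto
    finally have "ennreal r = (SUP C\<in>{C \<in> V. C \<subseteq> F n \<inter> R \<and> m C < \<infinity>}. m C)"
      using m_inner[of "F n \<inter> R"] r by simp
    moreover have "ennreal (r - d n) < ennreal r" using r0 d0[of n] by (intro ennreal_lessI) auto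
    ultimately obtain C where C: "C \<in> V" "C \<subseteq> F n \<inter> R" "m C < \<infinity>" "ennreal (r - d n) < m C"
      by (auto simp: less_SUP_iff)
    have eq: "m R = m C + m (R - C)" using C R by (intro m_Diff) auto
    obtain c where c: "m C = ennreal c" "0 \<le> c" using C(3) by (cases "m C") auto
    obtain e where e: "m (R - C) = ennreal e" "0 \<le> e"
      by (cases "m (R - C)") (use eq r in auto)
    have "ennreal r = ennreal (c + e)" using eq r c e by simp
    then have "r = c + e" using r0 c e by (subst (asm) ennreal_inj) auto
    moreover have "r - d n < c" using C(4) c(1) by (metis ennreal_leI not_le)
    ultimately have "m (R - C) \<le> ennreal (d n)" unfolding e by (intro ennreal_leI) simp
    then show ?thesis using C by blast
  qed
  then obtain C where C: "\<And>n. C n \<in> V" "\<And>n. C n \<subseteq> F n" "\<And>n. C n \<subseteq> R" "\<And>n. m (R - C n) \<le> ennreal (d n)"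
    by metis
  let ?W = "clopen_hull (\<Union>n. R - C n)"
  have RC: "range (\<lambda>n. R - C n) \<subseteq> V" using R C by auto
  have "m ?W \<le> (\<Sum>n. m (R - C n))" by (rule m_hull_le_suminf[OF RC])
  also have "\<dots> \<le> (\<Sum>n. ennreal (d n))" using C(4) by (intro suminf_le) auto
  also have "\<dots> = ennreal (r / 2)"
    using dsum d0 by (subst suminf_ennreal2) (auto simp: sums_iff less_imp_le)
  also have "\<dots> < m R" using r0 by (simp add: r ennreal_lessI)
  finally have "?W \<noteq> R" by auto
  moreover have "?W \<subseteq> R" by (rule hull_least[OF RC R(1)]) auto
  ultimately have ne: "R - ?W \<noteq> {}" by auto
  have "R - ?W \<subseteq> C n" for n using hull_upper[OF RC] by auto
  then have "R - ?W \<subseteq> (\<Inter>n. F n)" using C(2) by blast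
  moreover have "R - ?W \<in> V" using R(1) hull_in[OF RC] by auto
  ultimately show "\<exists>C\<in>V. C \<noteq> {} \<and> C \<subseteq> B \<and> C \<subseteq> (\<Inter>n. F n)"
    using ne R(3) by (intro bexI[of _ "R - ?W"]) auto
qed

section \<open>The \<sigma>-algebra and the measure\<close>

text \<open>These are the sets whose boundary is nowhere dense: the interiors of \<open>E\<close>
  and of its complement are together dense.\<close>

definition Sig :: "'x set set" where
  "Sig = {E. E \<subseteq> X \<and> clopen_inner E \<union> clopen_inner (X - E) = X}"

text \<open>The two clopen interiors are disjoint, since their intersection is the clopen interior
  of the empty set.\<close>

lemma inner_Compl:
  assumes "E \<in> Sig"
  shows "clopen_inner (X - E) = X - clopen_inner E"
proof -
  have "clopen_inner E \<inter> clopen_inner (X - E) = clopen_inner (E \<inter> (X - E))" by (rule inner_Int[symmetric])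
  also have "\<dots> = {}" using inner_clopen[of "{}"] by simp
  finally show ?thesis using assms unfolding Sig_def by blast
qed

lemma SigI:
  assumes "E \<subseteq> X" "X - clopen_inner E \<subseteq> clopen_inner (X - E)"
  shows "E \<in> Sig"
  using assms V_subset[OF inner_in] unfolding Sig_def by blast

lemma V_Sig: "B \<in> V \<Longrightarrow> B \<in> Sig"
  by (intro SigI) (simp_all add: inner_clopen compl_sets V_subset)

lemma sigma_algebra_Sig: "sigma_algebra X Sig"
  unfolding sigma_algebra_iff2
proof (intro conjI ballI allI impI)
  show "Sig \<subseteq> Pow X" by (auto simp: Sig_def)
  show "{} \<in> Sig" by (simp add: V_Sig)
  show "X - E \<in> Sig" if "E \<in> Sig" for E
    using that by (auto simp: Sig_def double_diff Un_commute)
  fix E :: "nat \<Rightarrow> 'x set" assume "range E \<subseteq> Sig"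
  then have E: "E n \<in> Sig" for n by auto
  \<comment> \<open>\<open>?Q\<close> has to lie in the clopen interior of the complement of the
    union. It lies in that of each \<open>X - E n\<close>, and \<open>inner_INT\<close> passes to
    all of them at once.\<close>
  let ?Q = "X - clopen_inner (\<Union>n. E n)"
  have "?Q \<subseteq> clopen_inner (X - E n)" for n
    using inner_Compl[OF E] inner_mono[of "E n" "\<Union>n. E n"] by auto
  then have "?Q \<subseteq> clopen_inner (\<Inter>n. X - E n)"
    using inner_in by (intro inner_INT) auto
  also have "(\<Inter>n. X - E n) = X - (\<Union>n. E n)" by auto
  finally show "(\<Union>n. E n) \<in> Sig" using E by (intro SigI) (auto simp: Sig_def)
qed

definition M :: "'x measure" where
  "M = measure_of X Sig (\<lambda>E. m (clopen_inner E))"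

text \<open>The clopen part \<open>?Q\<close> of the left side outside the right misses each
  \<open>clopen_inner (E n)\<close>. By \<open>inner_INT\<close> it then lies in the clopen interior
  of the complement of the union, which is disjoint from the left side; so it is empty.\<close>

lemma inner_UN:
  fixes E :: "nat \<Rightarrow> 'x set"
  assumes E: "\<And>n. E n \<in> Sig"
  shows "clopen_inner (\<Union>n. E n) = clopen_hull (\<Union>n. clopen_inner (E n))"
proof
  have r: "range (\<lambda>n. clopen_inner (E n)) \<subseteq> V" using inner_in by auto
  note H = hull_lub[OF r]
  show "clopen_hull (\<Union>n. clopen_inner (E n)) \<subseteq> clopen_inner (\<Union>n. E n)"
    using inner_mono[of "E _" "\<Union>n. E n"] by (intro H(3) inner_in) blast
  let ?Q = "clopen_inner (\<Union>n. E n) - clopen_hull (\<Union>n. clopen_inner (E n))"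
  have "?Q \<subseteq> clopen_inner (X - E n)" for n
    using inner_Compl[OF E, of n] H(2) V_subset[OF inner_in, of "\<Union>n. E n"] by auto
  then have "?Q \<subseteq> clopen_inner (\<Inter>n. X - E n)"
    using inner_in H(1) by (intro inner_INT) auto
  also have "(\<Inter>n. X - E n) = X - (\<Union>n. E n)" by auto
  also have "clopen_inner \<dots> = X - clopen_inner (\<Union>n. E n)"
    using E sigma_algebra.countable_nat_UN[OF sigma_algebra_Sig, of E] by (intro inner_Compl) auto
  finally show "clopen_inner (\<Union>n. E n) \<subseteq> clopen_hull (\<Union>n. clopen_inner (E n))" by auto
qed

lemma space_M: "space M = X" and sets_M: "sets M = Sig"
  unfolding M_def using sigma_algebra.space_measure_of_eq[OF sigma_algebra_Sig]
    sigma_algebra.sets_measure_of_eq[OF sigma_algebra_Sig] by auto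

text \<open>Disjoint sets have disjoint clopen interiors by \<open>inner_Int\<close>;
  \<open>inner_UN\<close> then turns countable additivity into \<open>m_additive\<close>.\<close>

lemma emeasure_M: "E \<in> Sig \<Longrightarrow> emeasure M E = m (clopen_inner E)"
  unfolding M_def
proof (rule emeasure_measure_of_sigma[OF sigma_algebra_Sig])
  show "positive Sig (\<lambda>E. m (clopen_inner E))"
    by (simp add: positive_def inner_clopen m_empty)
  show "countably_additive Sig (\<lambda>E. m (clopen_inner E))"
    unfolding countably_additive_def
  proof (intro allI impI)
    fix E :: "nat \<Rightarrow> 'x set"
    assume E: "range E \<subseteq> Sig" "disjoint_family E"
    have En: "E n \<in> Sig" for n using E by auto
    have r: "range (\<lambda>n. clopen_inner (E n)) \<subseteq> V" using inner_in by auto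
    have "clopen_inner (E i) \<inter> clopen_inner (E j) = {}" if "i \<noteq> j" for i j
      using E(2) that inner_clopen[of "{}"]
      by (simp add: inner_Int[symmetric] disjoint_family_on_def)
    then have "disjoint_family (\<lambda>n. clopen_inner (E n))" by (simp add: disjoint_family_on_def)
    then have "m (clopen_hull (\<Union>n. clopen_inner (E n))) = (\<Sum>n. m (clopen_inner (E n)))"
      using hull_lub[OF r] r by (intro m_additive) auto
    then show "(\<Sum>n. m (clopen_inner (E n))) = m (clopen_inner (\<Union>n. E n))"
      by (simp add: inner_UN[OF En])
  qed
qed

text \<open>The right side describes the nowhere dense sets. It passes to subsets by monotonicity,
  which gives completeness.\<close>

lemma null_sets_M: "E \<in> null_sets M \<longleftrightarrow> E \<subseteq> X \<and> clopen_inner (X - E) = X"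
proof
  assume "E \<in> null_sets M"
  then have E: "E \<in> Sig" "clopen_inner E = {}"
    using m_zero_iff[OF inner_in] by (auto simp: null_sets_def sets_M emeasure_M)
  then show "E \<subseteq> X \<and> clopen_inner (X - E) = X"
    using inner_Compl[OF E(1)] by (auto simp: Sig_def)
next
  assume E: "E \<subseteq> X \<and> clopen_inner (X - E) = X"
  then have S: "E \<in> Sig" by (intro SigI) auto
  have "clopen_inner E = {}" using inner_Compl[OF S] E V_subset[OF inner_in] by blast
  then show "E \<in> null_sets M" using S by (simp add: null_sets_def sets_M emeasure_M m_empty)
qed

section \<open>The topology and the Radon property\<close>

definition T :: "'x topology" where
  "T = topology (\<lambda>U. U \<subseteq> X \<and> (\<forall>x\<in>U. \<exists>B\<in>V. x \<in> B \<and> B \<subseteq> U))"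

lemma openin_T: "openin T U \<longleftrightarrow> U \<subseteq> X \<and> (\<forall>x\<in>U. \<exists>B\<in>V. x \<in> B \<and> B \<subseteq> U)"
proof -
  have "istopology (\<lambda>U. U \<subseteq> X \<and> (\<forall>x\<in>U. \<exists>B\<in>V. x \<in> B \<and> B \<subseteq> U))"
    unfolding istopology_def
  proof (intro conjI allI impI ballI)
    fix S S' x assume "S \<subseteq> X \<and> (\<forall>x\<in>S. \<exists>B\<in>V. x \<in> B \<and> B \<subseteq> S)"
      "S' \<subseteq> X \<and> (\<forall>x\<in>S'. \<exists>B\<in>V. x \<in> B \<and> B \<subseteq> S')" "x \<in> S \<inter> S'"
    then obtain B B' where "B \<in> V" "B' \<in> V" "x \<in> B" "x \<in> B'" "B \<subseteq> S" "B' \<subseteq> S'" by blast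
    then show "\<exists>B\<in>V. x \<in> B \<and> B \<subseteq> S \<inter> S'" by (intro bexI[of _ "B \<inter> B'"]) auto
  next
    fix \<K> x assume "\<forall>K\<in>\<K>. K \<subseteq> X \<and> (\<forall>x\<in>K. \<exists>B\<in>V. x \<in> B \<and> B \<subseteq> K)" "x \<in> \<Union>\<K>"
    then show "\<exists>B\<in>V. x \<in> B \<and> B \<subseteq> \<Union>\<K>" by (meson Union_iff Union_upper order_trans)
  qed blast+
  then show ?thesis unfolding T_def by (simp add: topology_inverse')
qed

lemma openin_V: "B \<in> V \<Longrightarrow> openin T B"
  using V_subset by (auto simp: openin_T)

lemma topspace_T: "topspace T = X"
  using openin_V[OF top] openin_T by (metis openin_subset openin_topspace subset_antisym)

lemma compactin_V:
  assumes B: "B \<in> V" "m B < \<infinity>"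
  shows "compactin T B"
  unfolding compactin_def topspace_T
proof (intro conjI allI impI)
  show "B \<subseteq> X" by (rule V_subset[OF B(1)])
  fix \<U> assume U: "(\<forall>U\<in>\<U>. openin T U) \<and> B \<subseteq> \<Union>\<U>"
  define \<C> where "\<C> = {C \<in> V. \<exists>U\<in>\<U>. C \<subseteq> U}"
  have "B \<subseteq> \<Union>\<C>"
  proof
    fix x assume "x \<in> B"
    then obtain U where "U \<in> \<U>" "x \<in> U" using U by auto
    then obtain C where "C \<in> V" "x \<in> C" "C \<subseteq> U" using U by (meson openin_T)
    then show "x \<in> \<Union>\<C>" using \<open>U \<in> \<U>\<close> by (auto simp: \<C>_def)
  qed
  then obtain \<F> where F: "\<F> \<subseteq> \<C>" "finite \<F>" "B \<subseteq> \<Union>\<F>"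
    using finite_subcover[OF B, of \<C>] by (auto simp: \<C>_def)
  then have "\<forall>C\<in>\<F>. \<exists>U. U \<in> \<U> \<and> C \<subseteq> U" by (auto simp: \<C>_def)
  then obtain u where "\<And>C. C \<in> \<F> \<Longrightarrow> u C \<in> \<U> \<and> C \<subseteq> u C" by metis
  then show "\<exists>\<F>. finite \<F> \<and> \<F> \<subseteq> \<U> \<and> B \<subseteq> \<Union>\<F>"
    using F(2,3) by (intro exI[of _ "u ` \<F>"] conjI) fastforce+
qed

lemma radon_M: "radon_space T M"
  unfolding radon_space_def
proof (intro conjI allI impI ballI)
  show "complete_measure M"
  proof
    fix A B assume "B \<subseteq> A" "A \<in> null_sets M"
    then have "B \<subseteq> X" "X \<subseteq> clopen_inner (X - B)"
      using inner_mono[of "X - A" "X - B"] by (auto simp: null_sets_M)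
    then show "B \<in> sets M" unfolding sets_M by (intro SigI) auto
  qed
  show "topspace T = space M" by (simp add: topspace_T space_M)
  show "Hausdorff_space T" unfolding Hausdorff_space_def topspace_T
  proof (intro allI impI)
    fix x y assume xy: "x \<in> X \<and> y \<in> X \<and> x \<noteq> y"
    then obtain B where "B \<in> V" "x \<in> B" "y \<notin> B" using separated by blast
    then have "openin T B \<and> openin T (X - B) \<and> x \<in> B \<and> y \<in> X - B \<and> disjnt B (X - B)"
      using xy openin_V[of B] openin_V[of "X - B"] by (auto simp: disjnt_def)
    then show "\<exists>U V. openin T U \<and> openin T V \<and> x \<in> U \<and> y \<in> V \<and> disjnt U V" by blast
  qed
  show "U \<in> sets M" if "openin T U" for U
    unfolding sets_M
  proof (rule SigI)
    show "U \<subseteq> X" using that by (simp add: openin_T)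
    \<comment> \<open>\<open>U\<close> is a union of members of \<open>V\<close>; hence the
      complement of \<open>clopen_inner U\<close> is a clopen set inside
      \<open>X - U\<close>.\<close>
    have "U \<subseteq> clopen_inner U"
    proof
      fix x assume "x \<in> U"
      then obtain B where B: "B \<in> V" "x \<in> B" "B \<subseteq> U" using \<open>openin T U\<close> by (meson openin_T)
      then show "x \<in> clopen_inner U" using inner_upper[OF B(1,3)] by auto
    qed
    then show "X - clopen_inner U \<subseteq> clopen_inner (X - U)" using inner_in by (intro inner_upper) auto
  qed
  show "\<exists>U. openin T U \<and> x \<in> U \<and> emeasure M U < \<infinity>" if x: "x \<in> space M" for x
  proof -
    obtain B where B: "B \<in> V" "x \<in> B" "m B < \<infinity>" using finite_nbhd x by (auto simp: space_M)
    then show ?thesis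
      by (intro exI[of _ B]) (simp add: openin_V emeasure_M V_Sig inner_clopen)
  qed
  show "E \<in> sets M" if E: "E \<subseteq> space M" "\<forall>F\<in>sets M. emeasure M F < \<infinity> \<longrightarrow> E \<inter> F \<in> sets M" for E
  proof -
    \<comment> \<open>Inside a clopen set that misses \<open>clopen_inner E\<close>, take
      \<open>C\<close> of finite measure. Then \<open>E \<inter> C\<close> is measurable with empty
      clopen interior, so some nonempty clopen part of \<open>C\<close> avoids
      \<open>E\<close>.\<close>
    have "X - clopen_inner E \<subseteq> clopen_inner (X - E)"
    proof (rule subset_innerI)
      fix B assume B: "B \<in> V" "B \<subseteq> X - clopen_inner E" "B \<noteq> {}"
      then obtain C where C: "C \<in> V" "C \<noteq> {}" "C \<subseteq> B" "m C < \<infinity>" using semifinite by blast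
      then have EC: "E \<inter> C \<in> Sig"
        using E(2) by (simp add: sets_M V_Sig emeasure_M inner_clopen)
      have "C \<inter> clopen_inner (E \<inter> C) = {}" using inner_mono[of "E \<inter> C" E] C B by blast
      then have "C \<subseteq> clopen_inner (X - E \<inter> C)"
        using inner_Compl[OF EC] V_subset[OF C(1)] by auto
      then obtain C' where "C' \<in> V" "C' \<noteq> {}" "C' \<subseteq> C" "C' \<subseteq> X - E \<inter> C"
        using inner_dense[OF C(1) _ C(2)] by blast
      then show "\<exists>C\<in>V. C \<noteq> {} \<and> C \<subseteq> B \<and> C \<subseteq> X - E" using C(3) by blast
    qed (use inner_in in auto)
    then show ?thesis using E(1) unfolding sets_M space_M by (rule SigI[rotated])
  qed
  show "emeasure M E = (SUP C\<in>{C. C \<subseteq> E \<and> compactin T C}. emeasure M C)" if E: "E \<in> sets M" for E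
  proof (rule antisym)
    \<comment> \<open>Inner regularity comes from \<open>m_inner\<close>, since clopen sets of
      finite measure are compact.\<close>
    have "emeasure M E = (SUP B\<in>{B \<in> V. B \<subseteq> E \<and> m B < \<infinity>}. m B)"
      using E by (simp add: sets_M emeasure_M m_inner)
    also have "\<dots> \<le> (SUP C\<in>{C. C \<subseteq> E \<and> compactin T C}. emeasure M C)"
    proof (rule SUP_mono)
      fix B assume "B \<in> {B \<in> V. B \<subseteq> E \<and> m B < \<infinity>}"
      then show "\<exists>C\<in>{C. C \<subseteq> E \<and> compactin T C}. m B \<le> emeasure M C"
        by (intro bexI[of _ B]) (auto simp: compactin_V emeasure_M V_Sig inner_clopen)
    qed
    finally show "emeasure M E \<le> (SUP C\<in>{C. C \<subseteq> E \<and> compactin T C}. emeasure M C)" .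
    show "(SUP C\<in>{C. C \<subseteq> E \<and> compactin T C}. emeasure M C) \<le> emeasure M E"
      using E by (intro SUP_least emeasure_mono) auto
  qed
qed

end


section \<open>Ultrafilters\<close>

context boolean_lattice
begin

definition complement :: "'a \<Rightarrow> 'a" where
  "complement x = (SOME y. y \<in> carrier L \<and> x \<squnion> y = \<top> \<and> x \<sqinter> y = \<bottom>)"

lemma complement:
  assumes "x \<in> carrier L"
  shows complement_closed [simp]: "complement x \<in> carrier L"
    and join_complement: "x \<squnion> complement x = \<top>" and meet_complement: "x \<sqinter> complement x = \<bottom>"
proof -
  have "complement x \<in> carrier L \<and> x \<squnion> complement x = \<top> \<and> x \<sqinter> complement x = \<bottom>"
    unfolding complement_def by (rule someI_ex) (use complement_exists[OF assms] in blast)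
  then show "complement x \<in> carrier L" "x \<squnion> complement x = \<top>" "x \<sqinter> complement x = \<bottom>" by auto
qed

lemma le_bottom: "x \<in> carrier L \<Longrightarrow> x \<sqsubseteq> \<bottom> \<Longrightarrow> x = \<bottom>"
  by (metis le_antisym bottom_closed bottom_lower)

lemma join_bottom: "x \<in> carrier L \<Longrightarrow> x \<squnion> \<bottom> = x"
  using bottom_join[of x] by (simp add: eq_is_equal join_comm)

lemma meet_top: "x \<in> carrier L \<Longrightarrow> x \<sqinter> \<top> = x"
  using top_meet[of x] by (simp add: eq_is_equal meet_comm)

lemma le_iff_meet_complement:
  assumes x: "x \<in> carrier L" and y: "y \<in> carrier L"
  shows "x \<sqsubseteq> y \<longleftrightarrow> x \<sqinter> complement y = \<bottom>"
proof
  assume le: "x \<sqsubseteq> y"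
  have "x \<sqinter> complement y \<sqsubseteq> y \<sqinter> complement y"
    using x y le by (intro meet_le) (auto intro: meet_right le_trans[OF meet_left])
  then show "x \<sqinter> complement y = \<bottom>" using x y by (intro le_bottom) (auto simp: meet_complement)
next
  assume b: "x \<sqinter> complement y = \<bottom>"
  have "x = x \<sqinter> (y \<squnion> complement y)" using x y by (simp add: join_complement meet_top)
  also have "\<dots> = x \<sqinter> y" using x y by (simp add: meet_join_distrib b join_bottom)
  finally have "x = x \<sqinter> y" .
  then show "x \<sqsubseteq> y" using meet_right[OF x y] by simp
qed

definition proper_filter :: "'a set \<Rightarrow> bool" where
  "proper_filter F \<longleftrightarrow> F \<subseteq> carrier L \<and> \<top> \<in> F \<and> \<bottom> \<notin> F \<and>
    (\<forall>x\<in>F. \<forall>y\<in>F. x \<sqinter> y \<in> F) \<and> (\<forall>x\<in>F. \<forall>y\<in>carrier L. x \<sqsubseteq> y \<longrightarrow> y \<in> F)"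

lemma proper_filterD:
  assumes "proper_filter F"
  shows "x \<in> F \<Longrightarrow> x \<in> carrier L" "\<top> \<in> F" "\<bottom> \<notin> F"
    "x \<in> F \<Longrightarrow> y \<in> F \<Longrightarrow> x \<sqinter> y \<in> F" "x \<in> F \<Longrightarrow> y \<in> carrier L \<Longrightarrow> x \<sqsubseteq> y \<Longrightarrow> y \<in> F"
  using assms unfolding proper_filter_def by auto

definition ultrafilter :: "'a set \<Rightarrow> bool" where
  "ultrafilter u \<longleftrightarrow> proper_filter u \<and> (\<forall>x\<in>carrier L. x \<in> u \<or> complement x \<in> u)"

text \<open>A maximal proper filter \<open>u\<close> decides every \<open>x\<close>: if
  \<open>x\<close> is not in \<open>u\<close>, the filter generated by both is improper, so some
  \<open>v\<close> in \<open>u\<close> satisfies \<open>v \<sqinter> x = \<bottom>\<close>, that is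
  \<open>v \<sqsubseteq> complement x\<close>.\<close>

lemma ultrafilter_exists:
  assumes F: "proper_filter F"
  shows "\<exists>u. ultrafilter u \<and> F \<subseteq> u"
proof -
  define \<A> where "\<A> = {G. proper_filter G \<and> F \<subseteq> G}"
  have "\<exists>u\<in>\<A>. \<forall>G\<in>\<A>. u \<subseteq> G \<longrightarrow> G = u"
  proof (rule subset_Zorn_nonempty)
    show "\<A> \<noteq> {}" using F by (auto simp: \<A>_def)
    fix \<C> assume C: "\<C> \<noteq> {}" "subset.chain \<A> \<C>"
    then have pf: "\<And>G. G \<in> \<C> \<Longrightarrow> proper_filter G" "\<And>G. G \<in> \<C> \<Longrightarrow> F \<subseteq> G"
      and lin: "\<And>G H. G \<in> \<C> \<Longrightarrow> H \<in> \<C> \<Longrightarrow> G \<subseteq> H \<or> H \<subseteq> G"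
      by (auto simp: subset_chain_def \<A>_def)
    have "proper_filter (\<Union>\<C>)" unfolding proper_filter_def
    proof (intro conjI ballI impI)
      show "\<Union>\<C> \<subseteq> carrier L" using proper_filterD(1)[OF pf(1)] by blast
      show "\<top> \<in> \<Union>\<C>" using proper_filterD(2)[OF pf(1)] C(1) by blast
      show "\<bottom> \<notin> \<Union>\<C>" using proper_filterD(3)[OF pf(1)] by blast
    next
      fix x y assume "x \<in> \<Union>\<C>" "y \<in> \<Union>\<C>"
      then obtain G H where GH: "G \<in> \<C>" "x \<in> G" "H \<in> \<C>" "y \<in> H" by blast
      have "\<exists>K\<in>\<C>. x \<in> K \<and> y \<in> K" using lin[OF GH(1,3)] GH by blast
      then show "x \<sqinter> y \<in> \<Union>\<C>" using proper_filterD(4)[OF pf(1)] by blast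
    next
      fix x y assume "x \<in> \<Union>\<C>" "y \<in> carrier L" "x \<sqsubseteq> y"
      then show "y \<in> \<Union>\<C>" using proper_filterD(5)[OF pf(1)] by blast
    qed
    then show "\<Union>\<C> \<in> \<A>" using pf(2) C(1) by (auto simp: \<A>_def)
  qed
  then obtain u where uA: "u \<in> \<A>" and mx: "\<forall>G\<in>\<A>. u \<subseteq> G \<longrightarrow> G = u" by (rule bexE)
  have u: "proper_filter u" "F \<subseteq> u" using uA by (simp_all add: \<A>_def)
  have max: "G = u" if "proper_filter G" "u \<subseteq> G" for G
  proof -
    have "G \<in> \<A>" using that u(2) by (auto simp: \<A>_def)
    then show ?thesis using mx that(2) by blast
  qed
  note uD = proper_filterD[OF u(1)]
  have "complement x \<in> u" if x: "x \<in> carrier L" "x \<notin> u" for x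
  proof -
    define G where "G = {y \<in> carrier L. \<exists>v\<in>u. v \<sqinter> x \<sqsubseteq> y}"
    have "u \<subseteq> G" unfolding G_def using uD(1) x(1) meet_left by blast
    have "x \<in> G" unfolding G_def using uD(2) x(1) meet_right[OF top_closed x(1)] by blast
    have "\<not> proper_filter G" using max[OF _ \<open>u \<subseteq> G\<close>] \<open>x \<in> G\<close> x(2) by blast
    moreover have "y \<sqinter> z \<in> G" if yz: "y \<in> G" "z \<in> G" for y z
    proof -
      obtain v w where v: "v \<in> u" "v \<sqinter> x \<sqsubseteq> y" and w: "w \<in> u" "w \<sqinter> x \<sqsubseteq> z"
        and c: "y \<in> carrier L" "z \<in> carrier L" using yz by (auto simp: G_def)
      have vw: "v \<in> carrier L" "w \<in> carrier L" using v w uD(1) by auto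
      let ?t = "v \<sqinter> w \<sqinter> x"
      have t: "?t \<in> carrier L" "?t \<sqsubseteq> v \<sqinter> w" "?t \<sqsubseteq> x"
        using vw x(1) by (auto intro: meet_left meet_right)
      have tv: "?t \<sqsubseteq> v" using le_trans[OF t(2) meet_left[OF vw]] vw x(1) by simp
      have tw: "?t \<sqsubseteq> w" using le_trans[OF t(2) meet_right[OF vw]] vw x(1) by simp
      have "?t \<sqsubseteq> v \<sqinter> x" using tv t vw x(1) by (intro meet_le)
      then have "?t \<sqsubseteq> y" using le_trans[OF _ v(2)] t vw x(1) c by simp
      moreover have "?t \<sqsubseteq> w \<sqinter> x" using tw t vw x(1) by (intro meet_le)
      then have "?t \<sqsubseteq> z" using le_trans[OF _ w(2)] t vw x(1) c by simp
      ultimately have "?t \<sqsubseteq> y \<sqinter> z" using t c by (intro meet_le)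
      then show ?thesis unfolding G_def using uD(4)[OF v(1) w(1)] c by auto
    qed
    moreover have "z \<in> G" if yz: "y \<in> G" "z \<in> carrier L" "y \<sqsubseteq> z" for y z
    proof -
      obtain v where v: "v \<in> u" "v \<sqinter> x \<sqsubseteq> y" "y \<in> carrier L" using yz(1) by (auto simp: G_def)
      then have "v \<sqinter> x \<sqsubseteq> z" using le_trans[OF v(2) yz(3)] uD(1) x(1) yz(2) by simp
      then show ?thesis unfolding G_def using v(1) yz(2) by auto
    qed
    moreover have "G \<subseteq> carrier L" "\<top> \<in> G" using uD(2) \<open>u \<subseteq> G\<close> by (auto simp: G_def)
    ultimately have "\<bottom> \<in> G" unfolding proper_filter_def by blast
    then obtain v where v: "v \<in> u" "v \<sqinter> x \<sqsubseteq> \<bottom>" by (auto simp: G_def)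
    have vc: "v \<in> carrier L" using v(1) uD(1) by auto
    \<comment> \<open>\<open>le_iff_meet_complement\<close> turns
      \<open>v \<sqsubseteq> complement x\<close> into a statement about the double complement,
      which is at most \<open>x\<close>.\<close>
    have "v \<sqinter> complement (complement x) = \<bottom>"
    proof -
      have "complement (complement x) \<sqsubseteq> x"
      proof -
        have "complement (complement x) \<sqinter> complement x = \<bottom>" using meet_complement[of "complement x"] x(1) by (simp add: meet_comm)
        then show ?thesis using x(1) by (simp add: le_iff_meet_complement)
      qed
      then have "v \<sqinter> complement (complement x) \<sqsubseteq> v \<sqinter> x"
        using vc x(1) le_trans[OF meet_right[of v "complement (complement x)"]] by (intro meet_le) (auto intro: meet_left)
      then have "v \<sqinter> complement (complement x) \<sqsubseteq> \<bottom>" using le_trans[OF _ v(2)] vc x(1) by simp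
      then show ?thesis using vc x(1) by (intro le_bottom) auto
    qed
    then have "v \<sqsubseteq> complement x" using vc x(1) by (simp add: le_iff_meet_complement)
    then show "complement x \<in> u" using uD(5)[OF v(1)] x(1) by simp
  qed
  then have "ultrafilter u" using u(1) by (auto simp: ultrafilter_def)
  then show ?thesis using u(2) by blast
qed

lemma principal_ultrafilter:
  assumes a: "a \<in> carrier L" "a \<noteq> \<bottom>"
  shows "\<exists>u. ultrafilter u \<and> a \<in> u"
proof -
  have "proper_filter {y \<in> carrier L. a \<sqsubseteq> y}"
    unfolding proper_filter_def using a le_bottom
    by (auto intro: meet_le le_trans)
  from ultrafilter_exists[OF this] show ?thesis using a by auto
qed

context
  fixes u assumes u: "ultrafilter u"
begin

lemma ultrafilter_filter: "proper_filter u"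
  using u by (simp add: ultrafilter_def)

lemma ultrafilter_mono: "x \<in> u \<Longrightarrow> y \<in> carrier L \<Longrightarrow> x \<sqsubseteq> y \<Longrightarrow> y \<in> u"
  using proper_filterD(5)[OF ultrafilter_filter] .

lemma ultrafilter_meet_iff:
  assumes xy: "x \<in> carrier L" "y \<in> carrier L"
  shows "x \<sqinter> y \<in> u \<longleftrightarrow> x \<in> u \<and> y \<in> u"
  using proper_filterD(4)[OF ultrafilter_filter, of x y]
    ultrafilter_mono[OF _ xy(1) meet_left[OF xy]] ultrafilter_mono[OF _ xy(2) meet_right[OF xy]]
  by auto

lemma ultrafilter_complement_iff: "x \<in> carrier L \<Longrightarrow> complement x \<in> u \<longleftrightarrow> x \<notin> u"
  using ultrafilter_meet_iff[of x "complement x"] meet_complement[of x] u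
    proper_filterD(3)[OF ultrafilter_filter] by (auto simp: ultrafilter_def)

lemma ultrafilter_join_iff:
  assumes xy: "x \<in> carrier L" "y \<in> carrier L"
  shows "x \<squnion> y \<in> u \<longleftrightarrow> x \<in> u \<or> y \<in> u"
proof
  assume j: "x \<squnion> y \<in> u"
  show "x \<in> u \<or> y \<in> u"
  proof (rule ccontr)
    assume n: "\<not> (x \<in> u \<or> y \<in> u)"
    then have "complement x \<in> u" using xy by (simp add: ultrafilter_complement_iff)
    then have "complement x \<sqinter> (x \<squnion> y) \<in> u" using j xy by (simp add: ultrafilter_meet_iff)
    also have "complement x \<sqinter> (x \<squnion> y) = (complement x \<sqinter> x) \<squnion> (complement x \<sqinter> y)"
      using xy by (intro meet_join_distrib) auto
    also have "\<dots> = complement x \<sqinter> y"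
      using xy meet_complement[of x] join_bottom[of "complement x \<sqinter> y"] join_comm[of L \<bottom>] meet_comm[of L "complement x" x]
      by simp
    finally show False using n xy by (simp add: ultrafilter_meet_iff)
  qed
next
  assume "x \<in> u \<or> y \<in> u"
  then show "x \<squnion> y \<in> u"
    using ultrafilter_mono[OF _ join_closed[OF xy] join_left[OF xy]]
      ultrafilter_mono[OF _ join_closed[OF xy] join_right[OF xy]] by auto
qed

end

end


section \<open>The Stone representation of a localizable measure algebra\<close>

text \<open>Bridges two forms of additivity: \<open>countably_additive\<close> sums over a set of
  elements, \<open>m_additive\<close> over a sequence. A disjoint sequence can repeat only the
  bottom element, here \<open>z\<close>, which contributes nothing.\<close>

lemma infsum_range_disjoint:
  fixes f :: "'a \<Rightarrow> ennreal" and a :: "nat \<Rightarrow> 'a"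
  assumes "f z = 0" and inj: "\<And>i j. i \<noteq> j \<Longrightarrow> a i = a j \<Longrightarrow> a i = z"
  shows "(\<Sum>\<^sub>\<infinity>p\<in>range a. f p) = (\<Sum>n. f (a n))"
proof -
  define I where "I = {n. a n \<noteq> z}"
  have "(\<Sum>\<^sub>\<infinity>p\<in>range a. f p) = (\<Sum>\<^sub>\<infinity>p\<in>a ` I. f p)"
    using assms(1) by (intro infsum_cong_neutral) (auto simp: I_def)
  also have "\<dots> = (\<Sum>\<^sub>\<infinity>n\<in>I. f (a n))"
    using inj by (subst infsum_reindex) (auto simp: I_def inj_on_def o_def)
  also have "\<dots> = (\<Sum>\<^sub>\<infinity>n. f (a n))"
    using assms(1) by (intro infsum_cong_neutral) (auto simp: I_def)
  also have "\<dots> = (\<Sum>n. f (a n))"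
    by (intro sums_unique has_sum_imp_sums has_sum_infsum nonneg_summable_on_complete) simp
  finally show ?thesis .
qed

locale localizable_measure_algebra = measure_algebra L \<mu>
  for L :: "'a gorder" (structure) and \<mu> +
  assumes localizable: "malg_localizable L \<mu>"
begin

definition stone_space :: "'a set set" where
  "stone_space = {u. ultrafilter u \<and> (\<exists>a\<in>u. \<mu> a < \<infinity>)}"

definition clopen :: "'a \<Rightarrow> 'a set set" where
  "clopen a = {u \<in> stone_space. a \<in> u}"

lemma stone_ultrafilter: "u \<in> stone_space \<Longrightarrow> ultrafilter u"
  by (simp add: stone_space_def)

lemma clopen_meet: "a \<in> carrier L \<Longrightarrow> b \<in> carrier L \<Longrightarrow> clopen (a \<sqinter> b) = clopen a \<inter> clopen b"
  by (auto simp: clopen_def ultrafilter_meet_iff[OF stone_ultrafilter])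

lemma clopen_join: "a \<in> carrier L \<Longrightarrow> b \<in> carrier L \<Longrightarrow> clopen (a \<squnion> b) = clopen a \<union> clopen b"
  by (auto simp: clopen_def ultrafilter_join_iff[OF stone_ultrafilter])

lemma clopen_complement: "a \<in> carrier L \<Longrightarrow> clopen (complement a) = stone_space - clopen a"
  by (auto simp: clopen_def ultrafilter_complement_iff[OF stone_ultrafilter])

lemma clopen_bottom: "clopen \<bottom> = {}"
  using proper_filterD(3)[OF ultrafilter_filter[OF stone_ultrafilter]] by (auto simp: clopen_def)

lemma semifinite_below:
  "p \<in> carrier L \<Longrightarrow> p \<noteq> \<bottom> \<Longrightarrow> \<exists>q\<in>carrier L. q \<noteq> \<bottom> \<and> q \<sqsubseteq> p \<and> \<mu> q < \<infinity>"
  using localizable by (simp add: malg_localizable_def malg_semifinite_def)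

text \<open>If \<open>a\<close> is not below \<open>b\<close>, semifiniteness gives a nonzero
  \<open>q\<close> of finite measure in the difference. An ultrafilter through \<open>q\<close> is a
  point of the restricted space that lies in \<open>clopen a\<close> but not in
  \<open>clopen b\<close>.\<close>

lemma clopen_le_iff:
  assumes a: "a \<in> carrier L" and b: "b \<in> carrier L"
  shows "clopen a \<subseteq> clopen b \<longleftrightarrow> a \<sqsubseteq> b"
proof
  assume "a \<sqsubseteq> b"
  then show "clopen a \<subseteq> clopen b"
    using ultrafilter_mono[OF stone_ultrafilter] b by (auto simp: clopen_def)
next
  assume sub: "clopen a \<subseteq> clopen b"
  show "a \<sqsubseteq> b"
  proof (rule ccontr)
    assume "\<not> a \<sqsubseteq> b"
    then have ne: "a \<sqinter> complement b \<noteq> \<bottom>" using a b by (simp add: le_iff_meet_complement)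
    have "a \<sqinter> complement b \<in> carrier L" using a b by simp
    from semifinite_below[OF this ne] obtain q where q: "q \<in> carrier L" "q \<noteq> \<bottom>" "q \<sqsubseteq> a \<sqinter> complement b" "\<mu> q < \<infinity>"
      by blast
    obtain u where u: "ultrafilter u" "q \<in> u" using principal_ultrafilter[OF q(1,2)] by blast
    have uS: "u \<in> stone_space" using u q(4) by (auto simp: stone_space_def)
    have "a \<sqinter> complement b \<in> u" using ultrafilter_mono[OF u] q(3) a b by simp
    then have "a \<in> u" "b \<notin> u"
      using a b by (auto simp: ultrafilter_meet_iff[OF u(1)] ultrafilter_complement_iff[OF u(1)])
    then show False using sub uS by (auto simp: clopen_def)
  qed
qed

lemma clopen_eq_iff: "a \<in> carrier L \<Longrightarrow> b \<in> carrier L \<Longrightarrow> clopen a = clopen b \<longleftrightarrow> a = b"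
  using clopen_le_iff le_antisym le_refl by (metis subset_antisym)

lemma clopen_empty_iff: "a \<in> carrier L \<Longrightarrow> clopen a = {} \<longleftrightarrow> a = \<bottom>"
  using clopen_eq_iff[of a \<bottom>] by (simp add: clopen_bottom)

definition clopen_mass :: "'a set set \<Rightarrow> ennreal" where
  "clopen_mass B = \<mu> (inv_into (carrier L) clopen B)"

lemma clopen_mass: "a \<in> carrier L \<Longrightarrow> clopen_mass (clopen a) = \<mu> a"
  unfolding clopen_mass_def using clopen_eq_iff by (subst inv_into_f_f) (auto simp: inj_on_def)

text \<open>If no finite subfamily covers, the elements whose clopen sets complete some finite
  subfamily to a cover of \<open>clopen a\<close> form a proper filter. An ultrafilter above it
  contains \<open>a\<close> and the complement of each element of the family, so it is an uncovered
  point of \<open>clopen a\<close>.\<close>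

lemma clopen_compact:
  assumes a: "a \<in> carrier L" "\<mu> a < \<infinity>"
    and C: "\<C> \<subseteq> clopen ` carrier L" "clopen a \<subseteq> \<Union>\<C>"
  shows "\<exists>\<F>\<subseteq>\<C>. finite \<F> \<and> clopen a \<subseteq> \<Union>\<F>"
proof (rule ccontr)
  assume no: "\<not> ?thesis"
  define F where "F = {y \<in> carrier L. \<exists>\<F>\<subseteq>\<C>. finite \<F> \<and> clopen a \<subseteq> clopen y \<union> \<Union>\<F>}"
  have "proper_filter F" unfolding proper_filter_def
  proof (intro conjI ballI impI)
    show "F \<subseteq> carrier L" by (auto simp: F_def)
    have "clopen \<top> = stone_space"
      using proper_filterD(2)[OF ultrafilter_filter[OF stone_ultrafilter]] by (auto simp: clopen_def)
    then show "\<top> \<in> F" unfolding F_def by (intro CollectI conjI exI[of _ "{}"]) (auto simp: clopen_def)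
    show "\<bottom> \<notin> F" using no by (auto simp: F_def clopen_bottom)
  next
    fix x y assume "x \<in> F" "y \<in> F"
    then obtain \<F> \<G> where xy: "x \<in> carrier L" "y \<in> carrier L"
      and F: "\<F> \<subseteq> \<C>" "finite \<F>" "clopen a \<subseteq> clopen x \<union> \<Union>\<F>"
      and G: "\<G> \<subseteq> \<C>" "finite \<G>" "clopen a \<subseteq> clopen y \<union> \<Union>\<G>"
      by (auto simp: F_def)
    have "clopen a \<subseteq> clopen (x \<sqinter> y) \<union> \<Union>(\<F> \<union> \<G>)"
      unfolding clopen_meet[OF xy] using F(3) G(3) by blast
    then show "x \<sqinter> y \<in> F" unfolding F_def
      using xy F G by (intro CollectI conjI exI[of _ "\<F> \<union> \<G>"]) auto
  next
    fix x y assume x: "x \<in> F" and y: "y \<in> carrier L" "x \<sqsubseteq> y"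
    then obtain \<F> where F: "x \<in> carrier L" "\<F> \<subseteq> \<C>" "finite \<F>" "clopen a \<subseteq> clopen x \<union> \<Union>\<F>"
      by (auto simp: F_def)
    have "clopen x \<subseteq> clopen y" using clopen_le_iff F(1) y by simp
    then have "clopen a \<subseteq> clopen y \<union> \<Union>\<F>" using F(4) by auto
    then show "y \<in> F" unfolding F_def using y F by (intro CollectI conjI exI[of _ \<F>])
  qed
  from ultrafilter_exists[OF this] obtain u where u: "ultrafilter u" "F \<subseteq> u" by blast
  have "a \<in> F" unfolding F_def using a by (intro CollectI conjI exI[of _ "{}"]) auto
  then have "a \<in> u" using u by auto
  \<comment> \<open>Here the finite measure of \<open>a\<close> enters: it makes \<open>u\<close> a
    point of the space.\<close>
  then have uS: "u \<in> stone_space" using u a by (auto simp: stone_space_def)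
  then have "u \<in> clopen a" using \<open>a \<in> u\<close> by (simp add: clopen_def)
  then obtain K where "K \<in> \<C>" "u \<in> K" using C(2) by auto
  then obtain c where c: "c \<in> carrier L" "clopen c \<in> \<C>" "u \<in> clopen c" using C(1) by auto
  have "complement c \<in> F" unfolding F_def
    using c by (intro CollectI conjI exI[of _ "{clopen c}"]) (auto simp: clopen_complement, auto simp: clopen_def)
  then have "c \<notin> u" using u c by (auto simp: ultrafilter_complement_iff[OF u(1), symmetric])
  then show False using c(3) by (simp add: clopen_def)
qed

lemma clopen_measure_stone: "clopen_measure stone_space (clopen ` carrier L) clopen_mass"
proof -
  interpret algebra stone_space "clopen ` carrier L"
    unfolding algebra_iff_Un
  proof (intro conjI ballI)
    show "clopen ` carrier L \<subseteq> Pow stone_space" by (auto simp: clopen_def)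
    show "{} \<in> clopen ` carrier L" using clopen_bottom by (metis bottom_closed imageI)
    show "stone_space - A \<in> clopen ` carrier L" if "A \<in> clopen ` carrier L" for A
      using that by (auto simp: clopen_complement[symmetric])
    show "A \<union> B \<in> clopen ` carrier L" if "A \<in> clopen ` carrier L" "B \<in> clopen ` carrier L" for A B
      using that by (auto simp: clopen_join[symmetric])
  qed
  \<comment> \<open>As \<open>clopen\<close> is an order embedding, the clopen sets containing a
    union correspond to upper bounds in the algebra, and suprema become hulls.\<close>
  have Upper: "clopen s \<supseteq> \<Union>(clopen ` D) \<longleftrightarrow> s \<in> Upper L D" if "D \<subseteq> carrier L" "s \<in> carrier L" for D s
    using that clopen_le_iff unfolding Upper_def by (simp add: UN_subset_iff) blast
  show ?thesis
  proof
    fix D assume "D \<subseteq> clopen ` carrier L"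
    then obtain D' where D': "D' \<subseteq> carrier L" "D = clopen ` D'" by (auto simp: subset_image_iff)
    obtain s where s: "least L s (Upper L D')"
      using localizable D'(1) by (auto simp: malg_localizable_def dedekind_complete_def)
    then have sU: "s \<in> Upper L D'" by (simp add: least_def)
    then have sc: "s \<in> carrier L" "s \<in> Upper L D'" by (simp_all add: Upper_def)
    show "\<exists>S\<in>clopen ` carrier L. \<Union>D \<subseteq> S \<and> (\<forall>W\<in>clopen ` carrier L. \<Union>D \<subseteq> W \<longrightarrow> S \<subseteq> W)"
    proof (intro bexI conjI ballI impI)
      show "\<Union>D \<subseteq> clopen s" using Upper[OF D'(1) sc(1)] sc(2) D'(2) by simp
      fix W assume W: "W \<in> clopen ` carrier L" "\<Union>D \<subseteq> W"
      then obtain w where w: "w \<in> carrier L" "W = clopen w" by auto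
      then have "s \<sqsubseteq> w" using Upper[OF D'(1) w(1)] W(2) D'(2) s by (simp add: least_def)
      then show "clopen s \<subseteq> W" using clopen_le_iff sc w by simp
    qed (use sc in auto)
  next
    fix B assume "B \<in> clopen ` carrier L"
    then show "clopen_mass B = 0 \<longleftrightarrow> B = {}"
      using clopen_mass[of \<bottom>] by (auto simp: clopen_mass clopen_empty_iff clopen_bottom measure_zero_iff)
  next
    fix A :: "nat \<Rightarrow> _" and S
    assume A: "range A \<subseteq> clopen ` carrier L" "disjoint_family A" and S: "S \<in> clopen ` carrier L" "(\<Union>n. A n) \<subseteq> S"
      and min: "\<And>W. W \<in> clopen ` carrier L \<Longrightarrow> (\<Union>n. A n) \<subseteq> W \<Longrightarrow> S \<subseteq> W"
    obtain s where s: "s \<in> carrier L" "S = clopen s" using S(1) by auto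
    have "\<forall>n. \<exists>a. a \<in> carrier L \<and> A n = clopen a" using A(1) by blast
    then obtain a where a: "\<And>n. a n \<in> carrier L" "\<And>n. A n = clopen (a n)" by metis
    have r: "range a \<subseteq> carrier L" using a(1) by auto
    have UA: "\<Union>(clopen ` range a) = (\<Union>n. A n)" using a(2) by auto
    have disj: "a i \<sqinter> a j = \<bottom>" if "i \<noteq> j" for i j
      using A(2) that a clopen_meet[of "a i" "a j"] clopen_empty_iff[of "a i \<sqinter> a j"]
      by (simp add: disjoint_family_on_def)
    have "s \<in> Upper L (range a)" using Upper[OF r s(1)] S(2) s(2) UA by simp
    moreover have "s \<sqsubseteq> w" if "w \<in> Upper L (range a)" for w
    proof -
      have w: "w \<in> carrier L" using that by (auto simp: Upper_def)
      then have "S \<subseteq> clopen w" using Upper[OF r w] that UA by (intro min) auto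
      then show ?thesis using clopen_le_iff s w by simp
    qed
    ultimately have "least L s (Upper L (range a))" by (simp add: least_def)
    then have "\<Squnion>(range a) = s" by (rule sup_eqI)
    moreover have "\<mu> (\<Squnion>(range a)) = (\<Sum>\<^sub>\<infinity>p\<in>range a. \<mu> p)"
    proof (rule countably_additive[OF r])
      show "p \<sqinter> q = \<bottom>" if "p \<in> range a" "q \<in> range a" "p \<noteq> q" for p q
        using that disj by (metis imageE)
    qed simp
    moreover have "(\<Sum>\<^sub>\<infinity>p\<in>range a. \<mu> p) = (\<Sum>n. \<mu> (a n))"
    proof (rule infsum_range_disjoint)
      show "\<mu> \<bottom> = 0" by (simp add: measure_zero_iff)
      fix i j assume "i \<noteq> j" "a i = a j"
      then have "clopen (a i) \<inter> clopen (a i) = {}"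
        using A(2) a(2) by (metis disjoint_family_on_def UNIV_I)
      then show "a i = \<bottom>" using clopen_empty_iff a(1) by simp
    qed
    ultimately show "clopen_mass S = (\<Sum>n. clopen_mass (A n))"
      using s a by (simp add: clopen_mass)
  next
    fix B assume B: "B \<in> clopen ` carrier L" "B \<noteq> {}"
    then obtain b where b: "b \<in> carrier L" "B = clopen b" "b \<noteq> \<bottom>" using clopen_bottom by auto
    obtain q where q: "q \<in> carrier L" "q \<noteq> \<bottom>" "q \<sqsubseteq> b" "\<mu> q < \<infinity>"
      using semifinite_below[OF b(1,3)] by blast
    then show "\<exists>C\<in>clopen ` carrier L. C \<noteq> {} \<and> C \<subseteq> B \<and> clopen_mass C < \<infinity>"
      using b by (intro bexI[of _ "clopen q"]) (auto simp: clopen_mass clopen_empty_iff clopen_le_iff[THEN iffD2, THEN subsetD])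
  next
    fix u assume u: "u \<in> stone_space"
    then obtain a where a: "a \<in> u" "\<mu> a < \<infinity>" by (auto simp: stone_space_def)
    have "a \<in> carrier L" using a(1) proper_filterD(1)[OF ultrafilter_filter[OF stone_ultrafilter[OF u]]] by simp
    then show "\<exists>B\<in>clopen ` carrier L. u \<in> B \<and> clopen_mass B < \<infinity>"
      using a u by (intro bexI[of _ "clopen a"]) (auto simp: clopen_mass, simp add: clopen_def)
  next
    fix u v assume uv: "u \<in> stone_space" "v \<in> stone_space" "u \<noteq> v"
    note ult = stone_ultrafilter[OF uv(1)] stone_ultrafilter[OF uv(2)]
    have sub: "u \<subseteq> carrier L" "v \<subseteq> carrier L"
      using proper_filterD(1)[OF ultrafilter_filter] ult by blast+
    have "\<exists>a\<in>carrier L. a \<in> u \<and> a \<notin> v"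
    proof (cases "u \<subseteq> v")
      case True
      then obtain b where b: "b \<in> v" "b \<notin> u" using uv(3) by blast
      then have "complement b \<in> u" "complement b \<notin> v" "complement b \<in> carrier L"
        using sub ultrafilter_complement_iff[OF ult(1), of b] ultrafilter_complement_iff[OF ult(2), of b] by auto
      then show ?thesis by blast
    next
      case False
      then show ?thesis using sub by blast
    qed
    then show "\<exists>B\<in>clopen ` carrier L. u \<in> B \<and> v \<notin> B"
      using uv by (auto simp: clopen_def)
  next
    fix B \<C> assume B: "B \<in> clopen ` carrier L" "clopen_mass B < \<infinity>"
      and C: "\<C> \<subseteq> clopen ` carrier L" "B \<subseteq> \<Union>\<C>"
    obtain b where b: "b \<in> carrier L" "B = clopen b" using B(1) by auto
    then show "\<exists>\<F>\<subseteq>\<C>. finite \<F> \<and> B \<subseteq> \<Union>\<F>"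
      using clopen_compact[of b \<C>] B C by (simp add: clopen_mass)
  qed
qed

sublocale stone: clopen_measure stone_space "clopen ` carrier L" clopen_mass
  by (rule clopen_measure_stone)

text \<open>Each measurable \<open>E\<close> differs from its clopen interior by a null set, so
  every class contains a clopen set. It is the only one because a null clopen set is empty.\<close>

lemma malg_isomorphic_stone: "malg_isomorphic L \<mu> (malg stone.M) (malg_measure stone.M)"
proof -
  let ?c = "\<lambda>E. null_rel stone.M `` {E}"
  note p = presents_malg[of stone.M]
  have null: "E \<in> null_sets stone.M \<longleftrightarrow> E \<in> sets stone.M \<and> stone.clopen_inner E = {}" for E
    using stone.m_zero_iff[OF stone.inner_in]
    by (auto simp: null_sets_def stone.sets_M stone.emeasure_M stone.m_empty)
  have cs: "clopen a \<in> sets stone.M" if "a \<in> carrier L" for a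
    using that stone.V_Sig by (simp add: stone.sets_M)
  have le: "?c (clopen a) \<sqsubseteq>\<^bsub>malg stone.M\<^esub> ?c (clopen b) \<longleftrightarrow> a \<sqsubseteq> b"
    if ab: "a \<in> carrier L" "b \<in> carrier L" for a b
  proof -
    have d: "clopen a - clopen b \<in> clopen ` carrier L" using ab by (intro stone.Diff) auto
    have "clopen a - clopen b \<in> null_sets stone.M \<longleftrightarrow> clopen a \<subseteq> clopen b"
      using d cs ab by (simp add: null stone.inner_clopen[OF d] sets.Diff)
    then show ?thesis using presents_le[OF p cs[OF ab(1)] cs[OF ab(2)]] clopen_le_iff[OF ab] by simp
  qed
  have "bij_betw (\<lambda>a. ?c (clopen a)) (carrier L) (carrier (malg stone.M))"
    unfolding bij_betw_def
  proof
    show "inj_on (\<lambda>a. ?c (clopen a)) (carrier L)"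
    proof (rule inj_onI)
      fix a b assume ab: "a \<in> carrier L" "b \<in> carrier L" "?c (clopen a) = ?c (clopen b)"
      have "a \<sqsubseteq> b" "b \<sqsubseteq> a" using le[OF ab(1,2)] le[OF ab(2,1)] le[OF ab(1,1)] ab by simp_all
      then show "a = b" using ab le_antisym by blast
    qed
    show "(\<lambda>a. ?c (clopen a)) ` carrier L = carrier (malg stone.M)"
    proof (intro subset_antisym subsetI)
      fix P assume "P \<in> carrier (malg stone.M)"
      then obtain E where E: "E \<in> sets stone.M" "P = ?c E"
        using p unfolding presents_def by (metis (no_types, lifting) imageE)
      obtain a where a: "a \<in> carrier L" "stone.clopen_inner E = clopen a"
        using stone.inner_in by auto
      have ES: "E \<in> stone.Sig" using E by (simp add: stone.sets_M)
      have compl: "stone.clopen_inner (stone_space - E) = stone_space - clopen a"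
        using stone.inner_Compl[OF ES] a by simp
      \<comment> \<open>Each of the two differences intersects a set of clopen interior
        \<open>clopen a\<close> with one whose clopen interior is the complement, so by
        \<open>inner_Int\<close> its own is empty.\<close>
      have "E - clopen a = E \<inter> (stone_space - clopen a)" using ES by (auto simp: stone.Sig_def)
      then have "stone.clopen_inner (E - clopen a) = clopen a \<inter> (stone_space - clopen a)"
        using stone.inner_Int[of E "stone_space - clopen a"] a
        by (simp add: stone.inner_clopen stone.compl_sets)
      moreover have "clopen a - E = clopen a \<inter> (stone_space - E)" by (auto simp: clopen_def)
      then have "stone.clopen_inner (clopen a - E) = clopen a \<inter> (stone_space - clopen a)"
        using stone.inner_Int[of "clopen a" "stone_space - E"] a compl by (simp add: stone.inner_clopen)
      ultimately have "E - clopen a \<in> null_sets stone.M" "clopen a - E \<in> null_sets stone.M"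
        using E(1) cs[OF a(1)] by (auto simp: null)
      then have "?c E = ?c (clopen a)"
        using E(1) cs[OF a(1)] null_rel_class[of "clopen a" stone.M E]
        by (intro equiv_class_eq[OF equiv_null_rel]) auto
      then show "P \<in> (\<lambda>a. ?c (clopen a)) ` carrier L" using E(2) a(1) by blast
    qed (use presents_carrier[OF p cs] in auto)
  qed
  then have "boolean_iso L (malg stone.M) (\<lambda>a. ?c (clopen a))"
    using le by (intro boolean_isoI bounded_lattice_axioms partial_order_malg)
  moreover have "malg_measure stone.M (?c (clopen a)) = \<mu> a" if "a \<in> carrier L" for a
    using that cs[OF that] stone.V_Sig[of "clopen a"]
    by (simp add: malg_measure_class stone.emeasure_M stone.inner_clopen clopen_mass)
  ultimately show ?thesis unfolding malg_isomorphic_def by blast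
qed

end

lemma radon_space_decomposable: "radon_space T M \<Longrightarrow> decomposable_space M"
  by (rule radon.decomposable[OF radon.intro])

lemma decomposable_space_localizable_space: "decomposable_space M \<Longrightarrow> localizable_space M"
  by (simp add: localizable_space_iff decomposable_space_localizable)

lemma localizable_space_malg_localizable:
  "\<lbrakk>measure_algebra A \<mu>; localizable_space M; malg_isomorphic A \<mu> (malg M) (malg_measure M)\<rbrakk>
    \<Longrightarrow> malg_localizable A \<mu>"
  by (simp add: malg_localizable_iff localizable_space_iff)

lemma malg_localizable_radon_space:
  fixes A :: "'a gorder" and \<mu> :: "'a \<Rightarrow> ennreal"
  assumes "measure_algebra A \<mu>" "malg_localizable A \<mu>"
  shows "\<exists>(T :: 'a set topology) M. radon_space T M \<and> malg_isomorphic A \<mu> (malg M) (malg_measure M)"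
proof -
  interpret localizable_measure_algebra A \<mu>
    using assms by (intro localizable_measure_algebra.intro localizable_measure_algebra_axioms.intro)
  show ?thesis using stone.radon_M malg_isomorphic_stone by blast
qed

text \<open>Quantifying over measure spaces means fixing a type of points. Points of the Stone
  representation are sets of elements of \<open>A\<close>, so the equivalences are stated over
  \<open>'a set\<close>; the implications to localizability hold over any type
  \<open>'b\<close>.\<close>

theorem theorem7p17:
  fixes A :: "'a gorder" and \<mu> :: "'a \<Rightarrow> ennreal"
  assumes "measure_algebra A \<mu>"
  shows
    "(malg_localizable A \<mu> \<longleftrightarrow>
        (\<exists>M :: 'a set measure. localizable_space M \<and>
          malg_isomorphic A \<mu> (malg M) (malg_measure M))) \<and>
     (malg_localizable A \<mu> \<longleftrightarrow>
        (\<exists>M :: 'a set measure. decomposable_space M \<and>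
          malg_isomorphic A \<mu> (malg M) (malg_measure M))) \<and>
     (malg_localizable A \<mu> \<longleftrightarrow>
        (\<exists>(T :: 'a set topology) M. radon_space T M \<and>
          malg_isomorphic A \<mu> (malg M) (malg_measure M))) \<and>
     ((\<exists>M :: 'b measure. localizable_space M \<and>
          malg_isomorphic A \<mu> (malg M) (malg_measure M)) \<longrightarrow> malg_localizable A \<mu>) \<and>
     ((\<exists>M :: 'b measure. decomposable_space M \<and>
          malg_isomorphic A \<mu> (malg M) (malg_measure M)) \<longrightarrow> malg_localizable A \<mu>) \<and>
     ((\<exists>(T :: 'b topology) M. radon_space T M \<and>
          malg_isomorphic A \<mu> (malg M) (malg_measure M)) \<longrightarrow> malg_localizable A \<mu>)"
proof -
  \<comment> \<open>The implications form a cycle: localizable algebra, Radon space, decomposable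
    space, localizable space, localizable algebra.\<close>
  note 21 = localizable_space_malg_localizable[OF assms]
    and 32 = decomposable_space_localizable_space and 43 = radon_space_decomposable
  have 14: "\<exists>(T :: 'a set topology) M. radon_space T M \<and> malg_isomorphic A \<mu> (malg M) (malg_measure M)"
    if "malg_localizable A \<mu>"
    by (rule malg_localizable_radon_space[OF assms that])
  have 13: "\<exists>M :: 'a set measure. decomposable_space M \<and> malg_isomorphic A \<mu> (malg M) (malg_measure M)"
    if "malg_localizable A \<mu>"
    using 14[OF that] 43 by blast
  have 12: "\<exists>M :: 'a set measure. localizable_space M \<and> malg_isomorphic A \<mu> (malg M) (malg_measure M)"
    if "malg_localizable A \<mu>"
    using 13[OF that] 32 by blast
  show ?thesis
    by (intro conjI iffI impI; (erule 12 13 14 | elim exE conjE, erule 21[rotated], auto intro: 32 43))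
qed

end
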